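(* Let $\mathcal C$ be a left $H$-category and let $\mathcal{M}$ and $\mathcal{N}$ be right $(\mathcal{C} \# H)$-modules. Then $Hom_{Mod\text{-}\mathcal C}(\mathcal{M},\mathcal{N})$ is a left $H$-module (with action $(h\cdot \eta)(X)(m)=\sum h_1\big(\eta(X)(S(h_2)m)\big)$ for $h\in H$, $X\in Ob(\mathcal C)$, $m\in\mathcal M(X)$) and its invariants are given by $$Hom_{Mod\text{-}\mathcal{C}}(\mathcal{M},\mathcal{N})^H=Hom_{Mod\text{-}(\mathcal{C}\#H)}(\mathcal{M},\mathcal{N}).$$
   Context: $K$ is a field and $H$ is a Hopf algebra over $K$ with comultiplication $\Delta(h)=\sum h_1\otimes h_2$, counit $\varepsilon$ and bijective antipode $S$. For a left $H$-module $M$, $M^H=\{m\in M\mid hm=\varepsilon(h)m\ \forall h\in H\}$. A left $H$-category $\mathcal C$ is a small $K$-linear category such that every $Hom_{\mathcal C}(X,Y)$ is a left $H$-module, $h(\mathrm{id}_X)=\varepsilon(h)\,\mathrm{id}_X$, and $h(fg)=\sum h_1(f)h_2(g)$ for all $h\in H$ and composable $g:X\to Y$, $f:Y\to Z$. For a small $K$-linear category $\mathcal E$, $Mod\text{-}\mathcal E$ is the category of right $\mathcal E$-modules, i.e. $K$-linear functors $\mathcal E^{op}\to Vect_K$. The smash product $\mathcal C\# H$ is the $K$-linear category with $Ob(\mathcal C\# H)=Ob(\mathcal C)$, $Hom_{\mathcal C\# H}(X,Y)=Hom_{\mathcal C}(X,Y)\otimes H$ (with $f\otimes h$ written $f\#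 h$), and composition $(f\# h)(g\# h')=\sum f(h_1g)\# (h_2h')$. A module $\mathcal M\in Mod\text{-}(\mathcal C\# H)$ is regarded as a right $\mathcal C$-module via $\mathcal M(f):=\mathcal M(f\#1_H)$, and each $\mathcal M(X)$ is a left $H$-module via $hm:=\mathcal M(\mathrm{id}_X\# S(h))(m)$. *)

theory Defs
  imports "HOL-Algebra.Module" "HOL-Algebra.AbelCoset"
begin

text \<open>
  A vector space over a field \<open>K\<close> is a \<^locale>\<open>module\<close> over \<open>K\<close>; the fields \<^const>\<open>mult\<close> and
  \<^const>\<open>one\<close> of its record carry no meaning unless it is also an algebra.
\<close>

section \<open>Linear maps and tensor products\<close>

definition linear_maps ::
  "('k, 'x) ring_scheme \<Rightarrow> ('k, 'a, 'y) module_scheme \<Rightarrow> ('k, 'b, 'z) module_scheme \<Rightarrow> ('a \<Rightarrow> 'b) set"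
  where
  "linear_maps K M N = {f \<in> carrier M \<rightarrow> carrier N.
     (\<forall>x\<in>carrier M. \<forall>y\<in>carrier M. f (x \<oplus>\<^bsub>M\<^esub> y) = f x \<oplus>\<^bsub>N\<^esub> f y) \<and>
     (\<forall>a\<in>carrier K. \<forall>x\<in>carrier M. f (a \<odot>\<^bsub>M\<^esub> x) = a \<odot>\<^bsub>N\<^esub> f x)}"

definition bilinear_maps ::
  "('k, 'x) ring_scheme \<Rightarrow> ('k, 'a, 'y) module_scheme \<Rightarrow> ('k, 'b, 'z) module_scheme
   \<Rightarrow> ('k, 'c, 'w) module_scheme \<Rightarrow> ('a \<Rightarrow> 'b \<Rightarrow> 'c) set"
  where
  "bilinear_maps K M N P = {\<phi>.
     (\<forall>x\<in>carrier M. \<phi> x \<in> linear_maps K N P) \<and>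
     (\<forall>y\<in>carrier N. (\<lambda>x. \<phi> x y) \<in> linear_maps K M P)}"

definition free_module :: "('k, 'x) ring_scheme \<Rightarrow> 'a set \<Rightarrow> ('k, 'a \<Rightarrow> 'k) module" where
  "free_module K B = \<lparr>
     carrier = {u. (\<forall>b. u b \<in> carrier K) \<and> finite {b. u b \<noteq> \<zero>\<^bsub>K\<^esub>} \<and> {b. u b \<noteq> \<zero>\<^bsub>K\<^esub>} \<subseteq> B},
     mult = undefined, one = undefined,
     zero = (\<lambda>b. \<zero>\<^bsub>K\<^esub>),
     add = (\<lambda>u v b. u b \<oplus>\<^bsub>K\<^esub> v b),
     smult = (\<lambda>a u b. a \<otimes>\<^bsub>K\<^esub> u b)\<rparr>"

definition free_basis :: "('k, 'x) ring_scheme \<Rightarrow> 'a \<Rightarrow> 'a \<Rightarrow> 'k" where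
  "free_basis K b = (\<lambda>b'. if b' = b then \<one>\<^bsub>K\<^esub> else \<zero>\<^bsub>K\<^esub>)"

definition tensor_relators ::
  "('k, 'x) ring_scheme \<Rightarrow> ('k, 'a, 'y) module_scheme \<Rightarrow> ('k, 'b, 'z) module_scheme
   \<Rightarrow> ('a \<times> 'b \<Rightarrow> 'k) set"
  where
  "tensor_relators K M N =
    (let F = free_module K (carrier M \<times> carrier N); e = (\<lambda>x y. free_basis K (x, y)) in
      {e (x \<oplus>\<^bsub>M\<^esub> x') y \<ominus>\<^bsub>F\<^esub> (e x y \<oplus>\<^bsub>F\<^esub> e x' y) | x x' y.
          x \<in> carrier M \<and> x' \<in> carrier M \<and> y \<in> carrier N}
    \<union> {e x (y \<oplus>\<^bsub>N\<^esub> y') \<ominus>\<^bsub>F\<^esub> (e x y \<oplus>\<^bsub>F\<^esub> e x y') | x y y'.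
          x \<in> carrier M \<and> y \<in> carrier N \<and> y' \<in> carrier N}
    \<union> {e (a \<odot>\<^bsub>M\<^esub> x) y \<ominus>\<^bsub>F\<^esub> a \<odot>\<^bsub>F\<^esub> e x y | a x y.
          a \<in> carrier K \<and> x \<in> carrier M \<and> y \<in> carrier N}
    \<union> {e x (a \<odot>\<^bsub>N\<^esub> y) \<ominus>\<^bsub>F\<^esub> a \<odot>\<^bsub>F\<^esub> e x y | a x y.
          a \<in> carrier K \<and> x \<in> carrier M \<and> y \<in> carrier N})"

definition tensor_kernel ::
  "('k, 'x) ring_scheme \<Rightarrow> ('k, 'a, 'y) module_scheme \<Rightarrow> ('k, 'b, 'z) module_scheme
   \<Rightarrow> ('a \<times> 'b \<Rightarrow> 'k) set"
  where
  "tensor_kernel K M N =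
     \<Inter> {U. submodule U K (free_module K (carrier M \<times> carrier N)) \<and> tensor_relators K M N \<subseteq> U}"

text \<open>The scalar multiple of a coset adds the kernel back, as \<open>\<zero> \<odot> A\<close> would otherwise be a singleton.\<close>

definition tensor ::
  "('k, 'x) ring_scheme \<Rightarrow> ('k, 'a, 'y) module_scheme \<Rightarrow> ('k, 'b, 'z) module_scheme
   \<Rightarrow> ('k, ('a \<times> 'b \<Rightarrow> 'k) set) module"
  where
  "tensor K M N =
    (let F = free_module K (carrier M \<times> carrier N); U = tensor_kernel K M N in \<lparr>
     carrier = a_rcosets\<^bsub>F\<^esub> U,
     mult = undefined, one = undefined,
     zero = U,
     add = (\<lambda>A B. A <+>\<^bsub>F\<^esub> B),
     smult = (\<lambda>a A. \<Union>u\<in>A. U +>\<^bsub>F\<^esub> (a \<odot>\<^bsub>F\<^esub> u))\<rparr>)"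

definition pure_tensor ::
  "('k, 'x) ring_scheme \<Rightarrow> ('k, 'a, 'y) module_scheme \<Rightarrow> ('k, 'b, 'z) module_scheme
   \<Rightarrow> 'a \<Rightarrow> 'b \<Rightarrow> ('a \<times> 'b \<Rightarrow> 'k) set"
  where
  "pure_tensor K M N x y =
     tensor_kernel K M N +>\<^bsub>free_module K (carrier M \<times> carrier N)\<^esub> free_basis K (x, y)"

text \<open>
  The map \<open>M \<otimes> N \<rightarrow> P\<close> induced by \<open>\<phi>\<close>, that is \<open>\<Sum> x\<^sub>i \<otimes> y\<^sub>i \<mapsto> \<Sum> \<phi> x\<^sub>i y\<^sub>i\<close>. It is independent of
  the chosen representative when \<open>\<phi> \<in> bilinear_maps K M N P\<close>, and is used only for such \<open>\<phi>\<close>.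
\<close>

definition tensor_lift ::
  "('k, 'x) ring_scheme \<Rightarrow> ('k, 'c, 'w) module_scheme
   \<Rightarrow> ('a \<Rightarrow> 'b \<Rightarrow> 'c) \<Rightarrow> ('a \<times> 'b \<Rightarrow> 'k) set \<Rightarrow> 'c"
  where
  "tensor_lift K P \<phi> t =
    (let u = (SOME u. u \<in> t) in
      (\<Oplus>\<^bsub>P\<^esub>p\<in>{p. u p \<noteq> \<zero>\<^bsub>K\<^esub>}. u p \<odot>\<^bsub>P\<^esub> \<phi> (fst p) (snd p)))"


section \<open>Hopf algebras and their modules\<close>

record ('k, 'h) hopf = "('k, 'h) module" +
  comult :: "'h \<Rightarrow> ('h \<times> 'h \<Rightarrow> 'k) set"
  counit :: "'h \<Rightarrow> 'k"
  antipode :: "'h \<Rightarrow> 'h"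

text \<open>\<open>sweedler K H P \<phi> h\<close> is \<open>\<Sum> \<phi> h\<^sub>1 h\<^sub>2 \<in> P\<close>, where \<open>\<Delta> h = \<Sum> h\<^sub>1 \<otimes> h\<^sub>2\<close>.\<close>

definition sweedler ::
  "('k, 'x) ring_scheme \<Rightarrow> ('k, 'h, 'y) hopf_scheme \<Rightarrow> ('k, 'c, 'w) module_scheme
   \<Rightarrow> ('h \<Rightarrow> 'h \<Rightarrow> 'c) \<Rightarrow> 'h \<Rightarrow> 'c"
  where
  "sweedler K H P \<phi> h = tensor_lift K P \<phi> (comult H h)"

text \<open>The library's \<^locale>\<open>algebra\<close> is commutative.\<close>

locale assoc_algebra = module K A + ring A
  for K :: "('k, 'x) ring_scheme" and A :: "('k, 'a, 'y) module_scheme" +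
  assumes smult_mult_left:
      "\<lbrakk>a \<in> carrier K; x \<in> carrier A; y \<in> carrier A\<rbrakk>
        \<Longrightarrow> (a \<odot>\<^bsub>A\<^esub> x) \<otimes>\<^bsub>A\<^esub> y = a \<odot>\<^bsub>A\<^esub> (x \<otimes>\<^bsub>A\<^esub> y)"
    and smult_mult_right:
      "\<lbrakk>a \<in> carrier K; x \<in> carrier A; y \<in> carrier A\<rbrakk>
        \<Longrightarrow> x \<otimes>\<^bsub>A\<^esub> (a \<odot>\<^bsub>A\<^esub> y) = a \<odot>\<^bsub>A\<^esub> (x \<otimes>\<^bsub>A\<^esub> y)"

text \<open>
  Coassociativity is an equation in \<open>H \<otimes> (H \<otimes> H)\<close>: its left side is the image of
  \<open>(\<Delta> \<otimes> id) (\<Delta> h)\<close> under the associator \<open>(a \<otimes> b) \<otimes> c \<mapsto> a \<otimes> (b \<otimes> c)\<close>. The right side of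
  \<open>comult_mult\<close> is the product of \<open>\<Delta> g\<close> and \<open>\<Delta> h\<close> in the algebra \<open>H \<otimes> H\<close>.
\<close>

locale hopf_algebra = field K + assoc_algebra K H
  for K :: "('k, 'x) ring_scheme" and H :: "('k, 'h, 'y) hopf_scheme" +
  assumes comult_linear: "comult H \<in> linear_maps K H (tensor K H H)"
    and counit_hom: "counit H \<in> ring_hom H K"
    and counit_smult:
      "\<lbrakk>a \<in> carrier K; h \<in> carrier H\<rbrakk> \<Longrightarrow> counit H (a \<odot>\<^bsub>H\<^esub> h) = a \<otimes>\<^bsub>K\<^esub> counit H h"
    and antipode_linear: "antipode H \<in> linear_maps K H H"
    and coassoc: "h \<in> carrier H \<Longrightarrow>
      sweedler K H (tensor K H (tensor K H H))
        (\<lambda>a c. sweedler K H (tensor K H (tensor K H H))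
           (\<lambda>a\<^sub>1 a\<^sub>2. pure_tensor K H (tensor K H H) a\<^sub>1 (pure_tensor K H H a\<^sub>2 c)) a) h
      = sweedler K H (tensor K H (tensor K H H))
          (\<lambda>a c. pure_tensor K H (tensor K H H) a (comult H c)) h"
    and counit_left: "h \<in> carrier H \<Longrightarrow> sweedler K H H (\<lambda>a b. counit H a \<odot>\<^bsub>H\<^esub> b) h = h"
    and counit_right: "h \<in> carrier H \<Longrightarrow> sweedler K H H (\<lambda>a b. counit H b \<odot>\<^bsub>H\<^esub> a) h = h"
    and comult_one: "comult H \<one>\<^bsub>H\<^esub> = pure_tensor K H H \<one>\<^bsub>H\<^esub> \<one>\<^bsub>H\<^esub>"
    and comult_mult: "\<lbrakk>g \<in> carrier H; h \<in> carrier H\<rbrakk> \<Longrightarrow>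
      comult H (g \<otimes>\<^bsub>H\<^esub> h) =
        sweedler K H (tensor K H H)
          (\<lambda>a b. sweedler K H (tensor K H H)
             (\<lambda>c d. pure_tensor K H H (a \<otimes>\<^bsub>H\<^esub> c) (b \<otimes>\<^bsub>H\<^esub> d)) h) g"
    and antipode_left: "h \<in> carrier H \<Longrightarrow>
      sweedler K H H (\<lambda>a b. antipode H a \<otimes>\<^bsub>H\<^esub> b) h = counit H h \<odot>\<^bsub>H\<^esub> \<one>\<^bsub>H\<^esub>"
    and antipode_right: "h \<in> carrier H \<Longrightarrow>
      sweedler K H H (\<lambda>a b. a \<otimes>\<^bsub>H\<^esub> antipode H b) h = counit H h \<odot>\<^bsub>H\<^esub> \<one>\<^bsub>H\<^esub>"

locale left_module = assoc_algebra K A + V: module K V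
  for K :: "('k, 'x) ring_scheme" and A :: "('k, 'a, 'y) module_scheme"
    and V :: "('k, 'v, 'z) module_scheme" and act :: "'a \<Rightarrow> 'v \<Rightarrow> 'v" +
  assumes act_bilinear: "act \<in> bilinear_maps K A V V"
    and act_mult: "\<lbrakk>g \<in> carrier A; h \<in> carrier A; v \<in> carrier V\<rbrakk>
      \<Longrightarrow> act (g \<otimes>\<^bsub>A\<^esub> h) v = act g (act h v)"
    and act_one: "v \<in> carrier V \<Longrightarrow> act \<one>\<^bsub>A\<^esub> v = v"

definition invariants ::
  "('k, 'h, 'y) hopf_scheme \<Rightarrow> ('k, 'v, 'z) module_scheme \<Rightarrow> ('h \<Rightarrow> 'v \<Rightarrow> 'v) \<Rightarrow> 'v set"
  where
  "invariants H V act = {v \<in> carrier V. \<forall>h\<in>carrier H. act h v = counit H h \<odot>\<^bsub>V\<^esub> v}"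


section \<open>Linear categories and their right modules\<close>

text \<open>
  Hom spaces at different pairs of objects need not be disjoint, so composition is indexed by
  objects: \<open>Cmp C X Y Z f g\<close> is \<open>f g\<close> for \<open>g : X \<rightarrow> Y\<close> and \<open>f : Y \<rightarrow> Z\<close>.
\<close>

record ('k, 'o, 'f) lincat =
  Ob :: "'o set"
  Hom :: "'o \<Rightarrow> 'o \<Rightarrow> ('k, 'f) module"
  Cmp :: "'o \<Rightarrow> 'o \<Rightarrow> 'o \<Rightarrow> 'f \<Rightarrow> 'f \<Rightarrow> 'f"
  Idt :: "'o \<Rightarrow> 'f"

locale linear_category = field K
  for K :: "('k, 'x) ring_scheme" and C :: "('k, 'o, 'f, 'z) lincat_scheme" +
  assumes Hom_module: "\<lbrakk>X \<in> Ob C; Y \<in> Ob C\<rbrakk> \<Longrightarrow> module K (Hom C X Y)"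
    and Idt_closed: "X \<in> Ob C \<Longrightarrow> Idt C X \<in> carrier (Hom C X X)"
    and Cmp_bilinear: "\<lbrakk>X \<in> Ob C; Y \<in> Ob C; Z \<in> Ob C\<rbrakk>
      \<Longrightarrow> Cmp C X Y Z \<in> bilinear_maps K (Hom C Y Z) (Hom C X Y) (Hom C X Z)"
    and Cmp_assoc: "\<lbrakk>W \<in> Ob C; X \<in> Ob C; Y \<in> Ob C; Z \<in> Ob C; f \<in> carrier (Hom C Y Z);
        g \<in> carrier (Hom C X Y); k \<in> carrier (Hom C W X)\<rbrakk>
      \<Longrightarrow> Cmp C W X Z (Cmp C X Y Z f g) k = Cmp C W Y Z f (Cmp C W X Y g k)"
    and Cmp_Idt_left: "\<lbrakk>X \<in> Ob C; Y \<in> Ob C; f \<in> carrier (Hom C X Y)\<rbrakk>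
      \<Longrightarrow> Cmp C X Y Y (Idt C Y) f = f"
    and Cmp_Idt_right: "\<lbrakk>X \<in> Ob C; Y \<in> Ob C; f \<in> carrier (Hom C X Y)\<rbrakk>
      \<Longrightarrow> Cmp C X X Y f (Idt C X) = f"

text \<open>\<open>Mor M X Y f : M(Y) \<rightarrow> M(X)\<close> for \<open>f : X \<rightarrow> Y\<close>.\<close>

record ('k, 'o, 'f, 'm) cat_module =
  Val :: "'o \<Rightarrow> ('k, 'm) module"
  Mor :: "'o \<Rightarrow> 'o \<Rightarrow> 'f \<Rightarrow> 'm \<Rightarrow> 'm"

locale right_cat_module =
  fixes K :: "('k, 'x) ring_scheme" and E :: "('k, 'o, 'f, 'z) lincat_scheme"
    and M :: "('k, 'o, 'f, 'm) cat_module"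
  assumes Val_module: "X \<in> Ob E \<Longrightarrow> module K (Val M X)"
    and Mor_bilinear: "\<lbrakk>X \<in> Ob E; Y \<in> Ob E\<rbrakk>
      \<Longrightarrow> Mor M X Y \<in> bilinear_maps K (Hom E X Y) (Val M Y) (Val M X)"
    and Mor_Idt: "\<lbrakk>X \<in> Ob E; m \<in> carrier (Val M X)\<rbrakk> \<Longrightarrow> Mor M X X (Idt E X) m = m"
    and Mor_Cmp: "\<lbrakk>X \<in> Ob E; Y \<in> Ob E; Z \<in> Ob E; f \<in> carrier (Hom E Y Z);
        g \<in> carrier (Hom E X Y); m \<in> carrier (Val M Z)\<rbrakk>
      \<Longrightarrow> Mor M X Z (Cmp E X Y Z f g) m = Mor M X Y g (Mor M Y Z f m)"

text \<open>
  Natural transformations with pointwise linear structure. The families and their components are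
  extensional (\<^const>\<open>undefined\<close> off the objects and off the carriers), so that equality of
  elements is equality of natural transformations.
\<close>

definition hom_mod ::
  "('k, 'x) ring_scheme \<Rightarrow> ('k, 'o, 'f, 'z) lincat_scheme \<Rightarrow> ('k, 'o, 'f, 'm) cat_module
   \<Rightarrow> ('k, 'o, 'f, 'n) cat_module \<Rightarrow> ('k, 'o \<Rightarrow> 'm \<Rightarrow> 'n) module"
  where
  "hom_mod K E M N = \<lparr>
     carrier = {\<eta> \<in> (\<Pi>\<^sub>E X\<in>Ob E. linear_maps K (Val M X) (Val N X) \<inter> extensional (carrier (Val M X))).
       \<forall>X\<in>Ob E. \<forall>Y\<in>Ob E. \<forall>f\<in>carrier (Hom E X Y). \<forall>m\<in>carrier (Val M Y).
         \<eta> X (Mor M X Y f m) = Mor N X Y f (\<eta> Y m)},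
     mult = undefined, one = undefined,
     zero = (\<lambda>X\<in>Ob E. \<lambda>m\<in>carrier (Val M X). \<zero>\<^bsub>Val N X\<^esub>),
     add = (\<lambda>\<eta> \<theta>. \<lambda>X\<in>Ob E. \<lambda>m\<in>carrier (Val M X). \<eta> X m \<oplus>\<^bsub>Val N X\<^esub> \<theta> X m),
     smult = (\<lambda>a \<eta>. \<lambda>X\<in>Ob E. \<lambda>m\<in>carrier (Val M X). a \<odot>\<^bsub>Val N X\<^esub> \<eta> X m)\<rparr>"


section \<open>H-categories and smash products\<close>

record ('k, 'o, 'f, 'h) hcat = "('k, 'o, 'f) lincat" +
  Act :: "'o \<Rightarrow> 'o \<Rightarrow> 'h \<Rightarrow> 'f \<Rightarrow> 'f"

locale left_H_category = hopf_algebra K H + linear_category K C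
  for K :: "('k, 'x) ring_scheme" and H :: "('k, 'h, 'y) hopf_scheme"
    and C :: "('k, 'o, 'f, 'h, 'z) hcat_scheme" +
  assumes Act_module: "\<lbrakk>X \<in> Ob C; Y \<in> Ob C\<rbrakk> \<Longrightarrow> left_module K H (Hom C X Y) (Act C X Y)"
    and Act_Idt: "\<lbrakk>X \<in> Ob C; h \<in> carrier H\<rbrakk>
      \<Longrightarrow> Act C X X h (Idt C X) = counit H h \<odot>\<^bsub>Hom C X X\<^esub> Idt C X"
    and Act_Cmp: "\<lbrakk>X \<in> Ob C; Y \<in> Ob C; Z \<in> Ob C; f \<in> carrier (Hom C Y Z);
        g \<in> carrier (Hom C X Y); h \<in> carrier H\<rbrakk>
      \<Longrightarrow> Act C X Z h (Cmp C X Y Z f g) =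
        sweedler K H (Hom C X Z)
          (\<lambda>h\<^sub>1 h\<^sub>2. Cmp C X Y Z (Act C Y Z h\<^sub>1 f) (Act C X Y h\<^sub>2 g)) h"

definition smash ::
  "('k, 'x) ring_scheme \<Rightarrow> ('k, 'h, 'y) hopf_scheme \<Rightarrow> ('k, 'o, 'f, 'h, 'z) hcat_scheme
   \<Rightarrow> ('k, 'o, ('f \<times> 'h \<Rightarrow> 'k) set) lincat"
  where
  "smash K H C = \<lparr>
     Ob = Ob C,
     Hom = (\<lambda>X Y. tensor K (Hom C X Y) H),
     Cmp = (\<lambda>X Y Z s t.
       let T = tensor K (Hom C X Z) H in
         tensor_lift K T (\<lambda>f h. tensor_lift K T (\<lambda>g h'.
           sweedler K H T (\<lambda>h\<^sub>1 h\<^sub>2.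
             pure_tensor K (Hom C X Z) H (Cmp C X Y Z f (Act C X Y h\<^sub>1 g)) (h\<^sub>2 \<otimes>\<^bsub>H\<^esub> h')) h) t) s),
     Idt = (\<lambda>X. pure_tensor K (Hom C X X) H (Idt C X) \<one>\<^bsub>H\<^esub>)\<rparr>"

definition restrict_smash ::
  "('k, 'x) ring_scheme \<Rightarrow> ('k, 'h, 'y) hopf_scheme \<Rightarrow> ('k, 'o, 'f, 'h, 'z) hcat_scheme
   \<Rightarrow> ('k, 'o, ('f \<times> 'h \<Rightarrow> 'k) set, 'm) cat_module \<Rightarrow> ('k, 'o, 'f, 'm) cat_module"
  where
  "restrict_smash K H C M = \<lparr>
     Val = Val M,
     Mor = (\<lambda>X Y f. Mor M X Y (pure_tensor K (Hom C X Y) H f \<one>\<^bsub>H\<^esub>))\<rparr>"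

definition val_act ::
  "('k, 'x) ring_scheme \<Rightarrow> ('k, 'h, 'y) hopf_scheme \<Rightarrow> ('k, 'o, 'f, 'h, 'z) hcat_scheme
   \<Rightarrow> ('k, 'o, ('f \<times> 'h \<Rightarrow> 'k) set, 'm) cat_module \<Rightarrow> 'o \<Rightarrow> 'h \<Rightarrow> 'm \<Rightarrow> 'm"
  where
  "val_act K H C M X h m = Mor M X X (pure_tensor K (Hom C X X) H (Idt C X) (antipode H h)) m"

definition hom_act ::
  "('k, 'x) ring_scheme \<Rightarrow> ('k, 'h, 'y) hopf_scheme \<Rightarrow> ('k, 'o, 'f, 'h, 'z) hcat_scheme
   \<Rightarrow> ('k, 'o, ('f \<times> 'h \<Rightarrow> 'k) set, 'm) cat_module \<Rightarrow> ('k, 'o, ('f \<times> 'h \<Rightarrow> 'k) set, 'n) cat_module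
   \<Rightarrow> 'h \<Rightarrow> ('o \<Rightarrow> 'm \<Rightarrow> 'n) \<Rightarrow> 'o \<Rightarrow> 'm \<Rightarrow> 'n"
  where
  "hom_act K H C M N h \<eta> = (\<lambda>X\<in>Ob C. \<lambda>m\<in>carrier (Val M X).
     sweedler K H (Val N X)
       (\<lambda>h\<^sub>1 h\<^sub>2. val_act K H C N X h\<^sub>1 (\<eta> X (val_act K H C M X (antipode H h\<^sub>2) m))) h)"

end

theory Submission
  imports Defs
begin

text \<open>
  Write \<open>m k\<close> for \<open>\<M>(id # k)(m)\<close> and \<open>m f\<close> for \<open>\<M>(f # 1)(m)\<close>, so that \<open>h m = m S(h)\<close>.
  The smash product gives \<open>(m k) f = \<Sum> (m (k\<^sub>1 f)) k\<^sub>2\<close>. Cancelling antipodes against this relation yields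
  \<open>(m f) S(h) = \<Sum> (m S(h\<^sub>1)) (h\<^sub>2 f)\<close> and \<open>(m f) S\<^sup>2(h) = \<Sum> (m S\<^sup>2(h\<^sub>2)) (S(h\<^sub>1) f)\<close>, and
  together these show that \<open>h \<cdot> \<eta>\<close> is again \<open>\<C>\<close>-linear.
  An invariant \<open>\<eta>\<close> satisfies
  \<open>h \<eta>(m) = \<Sum> h\<^sub>1 \<eta>(S(h\<^sub>2) h\<^sub>3 m) = \<Sum> (h\<^sub>1 \<cdot> \<eta>)(h\<^sub>2 m) = \<eta>(h m)\<close>,
  so it commutes with \<open>\<M>(id # S(h))\<close> for every \<open>h\<close>, and \<open>S\<close> is surjective. The converse is
  \<open>\<Sum> h\<^sub>1 S(h\<^sub>2) = \<epsilon>(h)\<close>. Finally \<open>f # k = (f # 1)(id # k)\<close>, and such tensors generate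
  the morphisms of the smash product.
\<close>

section \<open>Linear maps and free modules\<close>

text \<open>The Hopf axioms are equations in tensor powers of \<open>H\<close>, while
  \<open>sweedler\<close> evaluates at a representative picked by choice. This splits the calculus
  in two. Rewriting summands, exchanging sums and pushing a linear map inside are statements about
  one fixed representative. Rules that replace a value of \<open>comult\<close> (coassociativity,
  \<Delta>(1), \<Delta>(g h)) need a map that factors through the tensor product, hence one linear
  in every Sweedler variable; such linearity proofs are the recurrent side condition. Contravariance
  makes \<M>(id # k) a right action of \<open>H\<close>, and all computations are made with it. The
  left action inserts S, so S(h) m turns into m S(S(h)): this is where S^2 comes from. In the
  naturality of h \<cdot> \<eta>, moving f past S^2 makes an S(h_3) act on it, moving it past S
  makes an h_2 act on it, and the two meet as h_2 S(h_3). Passing between the left and the right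
  action needs S(g h) = S(h) S(g), which is not an axiom and is derived.\<close>

lemma linear_mapsI:
  assumes "\<And>x. x \<in> carrier M \<Longrightarrow> f x \<in> carrier N"
    and "\<And>x y. x \<in> carrier M \<Longrightarrow> y \<in> carrier M \<Longrightarrow> f (x \<oplus>\<^bsub>M\<^esub> y) = f x \<oplus>\<^bsub>N\<^esub> f y"
    and "\<And>a x. a \<in> carrier K \<Longrightarrow> x \<in> carrier M \<Longrightarrow> f (a \<odot>\<^bsub>M\<^esub> x) = a \<odot>\<^bsub>N\<^esub> f x"
  shows "f \<in> linear_maps K M N"
  using assms by (simp add: linear_maps_def)

lemma linear_mapsD:
  assumes "f \<in> linear_maps K M N"
  shows linear_maps_closed: "x \<in> carrier M \<Longrightarrow> f x \<in> carrier N"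
    and linear_maps_add: "x \<in> carrier M \<Longrightarrow> y \<in> carrier M \<Longrightarrow> f (x \<oplus>\<^bsub>M\<^esub> y) = f x \<oplus>\<^bsub>N\<^esub> f y"
    and linear_maps_smult: "a \<in> carrier K \<Longrightarrow> x \<in> carrier M \<Longrightarrow> f (a \<odot>\<^bsub>M\<^esub> x) = a \<odot>\<^bsub>N\<^esub> f x"
  using assms by (auto simp: linear_maps_def)

lemma bilinear_mapsI:
  assumes "\<And>x. x \<in> carrier M \<Longrightarrow> (\<lambda>y. \<phi> x y) \<in> linear_maps K N P"
    and "\<And>y. y \<in> carrier N \<Longrightarrow> (\<lambda>x. \<phi> x y) \<in> linear_maps K M P"
  shows "\<phi> \<in> bilinear_maps K M N P"
  using assms by (simp add: bilinear_maps_def)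

lemma bilinear_mapsD:
  assumes "\<phi> \<in> bilinear_maps K M N P"
  shows bilinear_maps_right: "x \<in> carrier M \<Longrightarrow> \<phi> x \<in> linear_maps K N P"
    and bilinear_maps_left: "y \<in> carrier N \<Longrightarrow> (\<lambda>x. \<phi> x y) \<in> linear_maps K M P"
    and bilinear_maps_closed: "x \<in> carrier M \<Longrightarrow> y \<in> carrier N \<Longrightarrow> \<phi> x y \<in> carrier P"
  using assms by (auto simp: bilinear_maps_def linear_maps_def)

lemma linear_maps_comp:
  assumes "f \<in> linear_maps K M N" and "g \<in> linear_maps K N P"
  shows "(\<lambda>x. g (f x)) \<in> linear_maps K M P"
  using assms by (auto intro!: linear_mapsI simp: linear_mapsD)

lemma linear_maps_id: "(\<lambda>x. x) \<in> linear_maps K M M"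
  by (auto intro: linear_mapsI)

text \<open>Homogeneity at the scalar 0 of \<open>K\<close> suffices; in
  \<open>linear_maps_minus\<close> the scalar -1 plays the same part.\<close>

lemma linear_maps_zero:
  assumes "module K M" and "module K N" and f: "f \<in> linear_maps K M N"
  shows "f \<zero>\<^bsub>M\<^esub> = \<zero>\<^bsub>N\<^esub>"
proof -
  interpret M: module K M by fact
  interpret N: module K N by fact
  have "f (\<zero>\<^bsub>K\<^esub> \<odot>\<^bsub>M\<^esub> \<zero>\<^bsub>M\<^esub>) = \<zero>\<^bsub>K\<^esub> \<odot>\<^bsub>N\<^esub> f \<zero>\<^bsub>M\<^esub>"
    using linear_maps_smult[OF f] by blast
  then show ?thesis
    using linear_maps_closed[OF f] by simp
qed

lemma linear_maps_minus:
  assumes "module K M" and "module K N" and f: "f \<in> linear_maps K M N"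
    and x: "x \<in> carrier M" and y: "y \<in> carrier M"
  shows "f (x \<ominus>\<^bsub>M\<^esub> y) = f x \<ominus>\<^bsub>N\<^esub> f y"
proof -
  interpret M: module K M by fact
  interpret N: module K N by fact
  have "f ((\<ominus>\<^bsub>K\<^esub> \<one>\<^bsub>K\<^esub>) \<odot>\<^bsub>M\<^esub> y) = (\<ominus>\<^bsub>K\<^esub> \<one>\<^bsub>K\<^esub>) \<odot>\<^bsub>N\<^esub> f y"
    using linear_maps_smult[OF f] y by blast
  then have "f (\<ominus>\<^bsub>M\<^esub> y) = \<ominus>\<^bsub>N\<^esub> f y"
    using linear_maps_closed[OF f] y by (simp add: M.smult_l_minus N.smult_l_minus)
  then show ?thesis
    using linear_maps_add[OF f] x y by (simp add: a_minus_def)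
qed

lemma linear_maps_finsum:
  assumes "module K M" and "module K N" and f: "f \<in> linear_maps K M N"
    and g: "g \<in> A \<rightarrow> carrier M"
  shows "f (\<Oplus>\<^bsub>M\<^esub>i\<in>A. g i) = (\<Oplus>\<^bsub>N\<^esub>i\<in>A. f (g i))"
proof -
  interpret M: module K M by fact
  interpret N: module K N by fact
  show ?thesis
    using g
  \<comment> \<open>A \<open>finsum\<close> over an infinite index set is zero by convention, so
    that case reduces to \<open>f\<close> preserving zero.\<close>
  proof (induction A rule: infinite_finite_induct)
    case (insert a A)
    then have "g \<in> A \<rightarrow> carrier M" "g a \<in> carrier M" by auto
    moreover from this have "(\<lambda>i. f (g i)) \<in> A \<rightarrow> carrier N" "f (g a) \<in> carrier N"
      using linear_maps_closed[OF f] by (auto simp: Pi_iff)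
    ultimately show ?case
      using insert by (simp add: M.finsum_insert N.finsum_insert linear_maps_add[OF f])
  qed (simp_all add: linear_maps_zero[OF assms(1-3)])
qed

lemma (in abelian_monoid) finsum_swap:
  assumes "finite A" and "finite B" and f: "\<And>i j. i \<in> A \<Longrightarrow> j \<in> B \<Longrightarrow> f i j \<in> carrier G"
  shows "(\<Oplus>i\<in>A. \<Oplus>j\<in>B. f i j) = (\<Oplus>j\<in>B. \<Oplus>i\<in>A. f i j)"
  using assms(1) f
proof (induction A)
  case empty
  then show ?case by (simp add: finsum_zero)
next
  case (insert a A)
  then have *: "\<And>j. j \<in> B \<Longrightarrow> f a j \<in> carrier G" "\<And>i j. i \<in> A \<Longrightarrow> j \<in> B \<Longrightarrow> f i j \<in> carrier G"
    by auto
  then have "(\<Oplus>j\<in>B. \<Oplus>i\<in>insert a A. f i j) = (\<Oplus>j\<in>B. f a j \<oplus> (\<Oplus>i\<in>A. f i j))"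
    using insert(1,2) by (intro finsum_cong) (auto simp: simp_implies_def intro!: finsum_insert)
  also have "\<dots> = (\<Oplus>j\<in>B. f a j) \<oplus> (\<Oplus>j\<in>B. \<Oplus>i\<in>A. f i j)"
    using * by (intro finsum_addf) (auto intro!: finsum_closed)
  finally show ?case
    using insert * by (simp add: finsum_insert Pi_iff)
qed

section \<open>Free modules and the universal property of their bases\<close>

lemma free_module_simps:
  "u \<in> carrier (free_module K B) \<longleftrightarrow>
    (\<forall>b. u b \<in> carrier K) \<and> finite {b. u b \<noteq> \<zero>\<^bsub>K\<^esub>} \<and> {b. u b \<noteq> \<zero>\<^bsub>K\<^esub>} \<subseteq> B"
  "u \<oplus>\<^bsub>free_module K B\<^esub> v = (\<lambda>b. u b \<oplus>\<^bsub>K\<^esub> v b)"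
  "a \<odot>\<^bsub>free_module K B\<^esub> u = (\<lambda>b. a \<otimes>\<^bsub>K\<^esub> u b)"
  "\<zero>\<^bsub>free_module K B\<^esub> = (\<lambda>b. \<zero>\<^bsub>K\<^esub>)"
  by (auto simp: free_module_def)

context field
begin

lemma free_module_add_closed:
  assumes "u \<in> carrier (free_module R B)" and "v \<in> carrier (free_module R B)"
  shows "u \<oplus>\<^bsub>free_module R B\<^esub> v \<in> carrier (free_module R B)"
proof -
  have "{b. u b \<oplus> v b \<noteq> \<zero>} \<subseteq> {b. u b \<noteq> \<zero>} \<union> {b. v b \<noteq> \<zero>}" by auto
  with assms show ?thesis
    unfolding free_module_simps by (meson a_closed finite_UnI finite_subset le_sup_iff order_trans)
qed

lemma free_module_smult_closed:
  assumes "a \<in> carrier R" and "u \<in> carrier (free_module R B)"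
  shows "a \<odot>\<^bsub>free_module R B\<^esub> u \<in> carrier (free_module R B)"
proof -
  have "{b. a \<otimes> u b \<noteq> \<zero>} \<subseteq> {b. u b \<noteq> \<zero>}" using assms by auto
  with assms show ?thesis
    unfolding free_module_simps by (meson m_closed finite_subset order_trans)
qed

lemma free_module_is_module: "module R (free_module R B)"
proof (rule moduleI)
  show "abelian_group (free_module R B)"
  proof (rule abelian_groupI)
    fix u
    assume u: "u \<in> carrier (free_module R B)"
    \<comment> \<open>The additive inverse is taken to be -1 times \<open>u\<close>, so that closure
      under scalars supplies its finite support.\<close>
    then have "(\<ominus> \<one>) \<odot>\<^bsub>free_module R B\<^esub> u \<in> carrier (free_module R B)"
      by (intro free_module_smult_closed) auto
    moreover have "(\<ominus> \<one>) \<odot>\<^bsub>free_module R B\<^esub> u \<oplus>\<^bsub>free_module R B\<^esub> u = \<zero>\<^bsub>free_module R B\<^esub>"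
      using u by (auto simp: free_module_simps l_minus l_neg)
    ultimately show "\<exists>v\<in>carrier (free_module R B). v \<oplus>\<^bsub>free_module R B\<^esub> u = \<zero>\<^bsub>free_module R B\<^esub>"
      by blast
  qed (simp_all add: free_module_add_closed, auto simp: free_module_simps a_ac)
qed (simp_all add: is_cring free_module_smult_closed,
    auto simp: free_module_simps l_distr r_distr m_assoc)

lemma free_basis_closed: "b \<in> B \<Longrightarrow> free_basis R b \<in> carrier (free_module R B)"
  by (auto simp: free_module_simps free_basis_def)

text \<open>The induction runs over a finite set containing the support instead of the support
  itself, so that a point where \<open>u\<close> vanishes can simply be dropped.\<close>

lemma free_module_linear_eqI:
  assumes P: "module R P" and f: "f \<in> linear_maps R (free_module R B) P"
    and g: "g \<in> linear_maps R (free_module R B) P"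
    and eq: "\<And>b. b \<in> B \<Longrightarrow> f (free_basis R b) = g (free_basis R b)"
    and u: "u \<in> carrier (free_module R B)"
  shows "f u = g u"
proof -
  interpret P: module R P by fact
  note zero = linear_maps_zero[OF free_module_is_module P]
  have "f u = g u" if "finite A" "{b. u b \<noteq> \<zero>} \<subseteq> A" "u \<in> carrier (free_module R B)" for A u
    using that
  proof (induction A arbitrary: u)
    case empty
    then have "u = \<zero>\<^bsub>free_module R B\<^esub>" by (auto simp: free_module_simps)
    then show ?case by (simp add: zero[OF f] zero[OF g])
  next
    case (insert a A)
    show ?case
    proof (cases "u a = \<zero>")
      case True
      then have "{b. u b \<noteq> \<zero>} \<subseteq> A" using insert(4) by auto
      then show ?thesis using insert by blast
    next
      case False
      then have a: "a \<in> B" "u a \<in> carrier R" using insert(5) by (auto simp: free_module_simps)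
      \<comment> \<open>Splitting off the coefficient at \<open>a\<close> leaves a vector supported
        in \<open>A\<close>, to which the induction hypothesis applies.\<close>
      let ?v = "u(a := \<zero>)"
      have supp: "{b. ?v b \<noteq> \<zero>} \<subseteq> {b. u b \<noteq> \<zero>}" "{b. ?v b \<noteq> \<zero>} \<subseteq> A"
        using insert(4) by auto
      then have v: "?v \<in> carrier (free_module R B)"
        using insert(5) finite_subset[OF supp(1)] order_trans[OF supp(1)]
        unfolding free_module_simps by simp
      note e = free_basis_closed[OF a(1)] free_module_smult_closed[OF a(2) free_basis_closed[OF a(1)]]
      have "u = u a \<odot>\<^bsub>free_module R B\<^esub> free_basis R a \<oplus>\<^bsub>free_module R B\<^esub> ?v"
        using insert(5) by (auto simp: free_module_simps free_basis_def)
      moreover have "f ?v = g ?v"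
        by (rule insert(3)[OF supp(2) v])
      then have "f (u a \<odot>\<^bsub>free_module R B\<^esub> free_basis R a \<oplus>\<^bsub>free_module R B\<^esub> ?v)
          = g (u a \<odot>\<^bsub>free_module R B\<^esub> free_basis R a \<oplus>\<^bsub>free_module R B\<^esub> ?v)"
        using e v a eq[OF a(1)]
        by (simp add: linear_maps_add[OF f] linear_maps_add[OF g]
            linear_maps_smult[OF f] linear_maps_smult[OF g])
      ultimately show ?thesis by simp
    qed
  qed
  then show ?thesis using u by (auto simp: free_module_simps)
qed

text \<open>The linear map out of the free module that sends the basis vector at \<open>p\<close> to
  \<open>\<phi> p\<close>. It is the sum inside \<open>tensor_lift\<close> with the choice of a
  representative split off.\<close>

definition linear_extension :: "('a, 'c, 'w) module_scheme \<Rightarrow> ('i \<Rightarrow> 'c) \<Rightarrow> ('i \<Rightarrow> 'a) \<Rightarrow> 'c" where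
  "linear_extension P \<phi> u = (\<Oplus>\<^bsub>P\<^esub>p\<in>{p. u p \<noteq> \<zero>}. u p \<odot>\<^bsub>P\<^esub> \<phi> p)"

text \<open>The index set of the defining sum moves with \<open>u\<close>. Vectors with different
  supports become comparable once their sums run over one common finite set.\<close>

lemma linear_extension_superset:
  assumes P: "module R P" and \<phi>: "\<phi> \<in> B \<rightarrow> carrier P" and u: "u \<in> carrier (free_module R B)"
    and A: "finite A" "A \<subseteq> B" "{p. u p \<noteq> \<zero>} \<subseteq> A"
  shows "linear_extension P \<phi> u = (\<Oplus>\<^bsub>P\<^esub>p\<in>A. u p \<odot>\<^bsub>P\<^esub> \<phi> p)"
proof -
  interpret P: module R P by fact
  show ?thesis
    unfolding linear_extension_def using A u \<phi>
    by (intro P.add.finprod_mono_neutral_cong_left) (auto simp: Pi_iff free_module_simps)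
qed

lemma linear_extension_linear:
  assumes P: "module R P" and \<phi>: "\<phi> \<in> B \<rightarrow> carrier P"
  shows "linear_extension P \<phi> \<in> linear_maps R (free_module R B) P"
proof (rule linear_mapsI)
  interpret P: module R P by fact
  note ext = linear_extension_superset[OF P \<phi>]
  have terms: "(\<lambda>p. u p \<odot>\<^bsub>P\<^esub> \<phi> p) \<in> B \<rightarrow> carrier P" if "u \<in> carrier (free_module R B)" for u
    using that \<phi> by (auto simp: free_module_simps)
  fix u
  assume u: "u \<in> carrier (free_module R B)"
  let ?S = "{p. u p \<noteq> \<zero>}"
  have S: "finite ?S" "?S \<subseteq> B" using u by (auto simp: free_module_simps)
  show "linear_extension P \<phi> u \<in> carrier P"
    using terms[OF u] S by (auto simp: linear_extension_def intro!: P.finsum_closed)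
  show "linear_extension P \<phi> (a \<odot>\<^bsub>free_module R B\<^esub> u) = a \<odot>\<^bsub>P\<^esub> linear_extension P \<phi> u"
    if a: "a \<in> carrier R" for a
  proof -
    have "linear_extension P \<phi> (a \<odot>\<^bsub>free_module R B\<^esub> u)
        = (\<Oplus>\<^bsub>P\<^esub>p\<in>?S. (a \<odot>\<^bsub>free_module R B\<^esub> u) p \<odot>\<^bsub>P\<^esub> \<phi> p)"
      using S a by (intro ext free_module_smult_closed u) (auto simp: free_module_simps)
    also have "\<dots> = (\<Oplus>\<^bsub>P\<^esub>p\<in>?S. a \<odot>\<^bsub>P\<^esub> (u p \<odot>\<^bsub>P\<^esub> \<phi> p))"
      using a u \<phi> S
      by (intro P.finsum_cong)
        (auto simp: simp_implies_def free_module_simps P.smult_assoc1 Pi_iff subset_iff)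
    also have "\<dots> = a \<odot>\<^bsub>P\<^esub> linear_extension P \<phi> u"
      unfolding linear_extension_def
      using S a terms[OF u] by (intro P.finsum_smult_ldistr[symmetric]) auto
    finally show ?thesis .
  qed
  fix v
  assume v: "v \<in> carrier (free_module R B)"
  \<comment> \<open>Coefficients may cancel in \<open>u\<close> plus \<open>v\<close>, so its
    support can be smaller than this union; all three sums are extended to the union.\<close>
  let ?A = "?S \<union> {p. v p \<noteq> \<zero>}"
  have A: "finite ?A" "?A \<subseteq> B" using u v by (auto simp: free_module_simps)
  have "linear_extension P \<phi> (u \<oplus>\<^bsub>free_module R B\<^esub> v)
      = (\<Oplus>\<^bsub>P\<^esub>p\<in>?A. (u \<oplus>\<^bsub>free_module R B\<^esub> v) p \<odot>\<^bsub>P\<^esub> \<phi> p)"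
    using A by (intro ext free_module_add_closed u v) (auto simp: free_module_simps)
  also have "\<dots> = (\<Oplus>\<^bsub>P\<^esub>p\<in>?A. u p \<odot>\<^bsub>P\<^esub> \<phi> p \<oplus>\<^bsub>P\<^esub> v p \<odot>\<^bsub>P\<^esub> \<phi> p)"
    using u v \<phi> A
    by (intro P.finsum_cong)
      (auto simp: simp_implies_def free_module_simps P.smult_l_distr Pi_iff subset_iff)
  also have "\<dots> = (\<Oplus>\<^bsub>P\<^esub>p\<in>?A. u p \<odot>\<^bsub>P\<^esub> \<phi> p) \<oplus>\<^bsub>P\<^esub> (\<Oplus>\<^bsub>P\<^esub>p\<in>?A. v p \<odot>\<^bsub>P\<^esub> \<phi> p)"
    using terms[OF u] terms[OF v] A by (intro P.finsum_addf) auto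
  also have "\<dots> = linear_extension P \<phi> u \<oplus>\<^bsub>P\<^esub> linear_extension P \<phi> v"
    using A by (simp add: ext[OF u A] ext[OF v A])
  finally show "linear_extension P \<phi> (u \<oplus>\<^bsub>free_module R B\<^esub> v)
      = linear_extension P \<phi> u \<oplus>\<^bsub>P\<^esub> linear_extension P \<phi> v" .
qed

lemma linear_extension_basis:
  assumes P: "module R P" and \<phi>: "\<phi> \<in> B \<rightarrow> carrier P" and b: "b \<in> B"
  shows "linear_extension P \<phi> (free_basis R b) = \<phi> b"
proof -
  interpret P: module R P by fact
  have "{p. free_basis R b p \<noteq> \<zero>} = {b}" by (auto simp: free_basis_def)
  then show ?thesis
    using \<phi> b by (auto simp: linear_extension_def free_basis_def P.finsum_insert Pi_iff)
qed

lemma linear_extension_comp: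
  assumes "module R P" and "module R Q" and f: "f \<in> linear_maps R P Q"
    and \<phi>: "\<phi> \<in> B \<rightarrow> carrier P" and u: "u \<in> carrier (free_module R B)"
  shows "f (linear_extension P \<phi> u) = linear_extension Q (\<lambda>p. f (\<phi> p)) u"
proof -
  interpret P: module R P by fact
  interpret Q: module R Q by fact
  have "f (linear_extension P \<phi> u) = (\<Oplus>\<^bsub>Q\<^esub>p\<in>{p. u p \<noteq> \<zero>}. f (u p \<odot>\<^bsub>P\<^esub> \<phi> p))"
    unfolding linear_extension_def
    using u \<phi> by (intro linear_maps_finsum[OF assms(1-3)]) (auto simp: free_module_simps)
  also have "\<dots> = linear_extension Q (\<lambda>p. f (\<phi> p)) u"
    unfolding linear_extension_def using u \<phi>
    by (intro Q.finsum_cong)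
      (auto simp: simp_implies_def linear_mapsD[OF f] free_module_simps Pi_iff subset_iff)
  finally show ?thesis .
qed

lemma linear_extension_cong:
  assumes P: "module R P" and u: "u \<in> carrier (free_module R B)" and \<phi>: "\<phi> \<in> B \<rightarrow> carrier P"
    and "\<And>p. p \<in> B \<Longrightarrow> \<phi> p = \<psi> p"
  shows "linear_extension P \<phi> u = linear_extension P \<psi> u"
proof -
  interpret P: module R P by fact
  show ?thesis
    unfolding linear_extension_def using assms
    by (intro P.finsum_cong') (auto simp: free_module_simps Pi_iff subset_iff)
qed

text \<open>Here the vector \<open>u\<close> is fixed and the summands vary linearly with a
  parameter. Commutativity of the field lets the new scalar pass the coefficients of
  \<open>u\<close>.\<close>

lemma linear_extension_linear_arg:
  assumes P: "module R P" and Q: "module R Q" and u: "u \<in> carrier (free_module R B)"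
    and \<phi>: "\<And>p. p \<in> B \<Longrightarrow> (\<lambda>x. \<phi> x p) \<in> linear_maps R Q P"
  shows "(\<lambda>x. linear_extension P (\<phi> x) u) \<in> linear_maps R Q P"
proof (rule linear_mapsI)
  interpret P: module R P by fact
  interpret Q: module R Q by fact
  let ?S = "{p. u p \<noteq> \<zero>}"
  have S: "finite ?S" "?S \<subseteq> B" "\<And>p. u p \<in> carrier R" using u by (auto simp: free_module_simps)
  have closed: "p \<in> ?S \<Longrightarrow> x \<in> carrier Q \<Longrightarrow> \<phi> x p \<in> carrier P" for p x
    using S \<phi>[of p] by (auto intro: linear_maps_closed[where f = "\<lambda>x. \<phi> x p"])
  fix x
  assume x: "x \<in> carrier Q"
  show "linear_extension P (\<phi> x) u \<in> carrier P"
    unfolding linear_extension_def using closed x S by (intro P.finsum_closed) auto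
  show "linear_extension P (\<phi> (x \<oplus>\<^bsub>Q\<^esub> y)) u = linear_extension P (\<phi> x) u \<oplus>\<^bsub>P\<^esub> linear_extension P (\<phi> y) u"
    if y: "y \<in> carrier Q" for y
  proof -
    have "linear_extension P (\<phi> (x \<oplus>\<^bsub>Q\<^esub> y)) u = (\<Oplus>\<^bsub>P\<^esub>p\<in>?S. u p \<odot>\<^bsub>P\<^esub> \<phi> x p \<oplus>\<^bsub>P\<^esub> u p \<odot>\<^bsub>P\<^esub> \<phi> y p)"
      unfolding linear_extension_def
      using closed x y S \<phi> linear_maps_add[OF \<phi> x y]
      by (intro P.finsum_cong') (auto simp: P.smult_r_distr)
    also have "\<dots> = linear_extension P (\<phi> x) u \<oplus>\<^bsub>P\<^esub> linear_extension P (\<phi> y) u"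
      unfolding linear_extension_def using closed x y S by (intro P.finsum_addf) auto
    finally show ?thesis .
  qed
  show "linear_extension P (\<phi> (a \<odot>\<^bsub>Q\<^esub> x)) u = a \<odot>\<^bsub>P\<^esub> linear_extension P (\<phi> x) u"
    if a: "a \<in> carrier R" for a
  proof -
    have "u p \<odot>\<^bsub>P\<^esub> \<phi> (a \<odot>\<^bsub>Q\<^esub> x) p = a \<odot>\<^bsub>P\<^esub> (u p \<odot>\<^bsub>P\<^esub> \<phi> x p)" if "p \<in> ?S" for p
    proof -
      have "u p \<odot>\<^bsub>P\<^esub> \<phi> (a \<odot>\<^bsub>Q\<^esub> x) p = (u p \<otimes> a) \<odot>\<^bsub>P\<^esub> \<phi> x p"
        using S that a x closed linear_maps_smult[OF \<phi> a x] by (auto simp: P.smult_assoc1)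
      also have "\<dots> = a \<odot>\<^bsub>P\<^esub> (u p \<odot>\<^bsub>P\<^esub> \<phi> x p)"
        using S that a x closed by (metis P.smult_assoc1 m_comm)
      finally show ?thesis .
    qed
    then have "linear_extension P (\<phi> (a \<odot>\<^bsub>Q\<^esub> x)) u = (\<Oplus>\<^bsub>P\<^esub>p\<in>?S. a \<odot>\<^bsub>P\<^esub> (u p \<odot>\<^bsub>P\<^esub> \<phi> x p))"
      unfolding linear_extension_def using closed x S a by (intro P.finsum_cong') auto
    also have "\<dots> = a \<odot>\<^bsub>P\<^esub> linear_extension P (\<phi> x) u"
      unfolding linear_extension_def
      using closed x S a by (intro P.finsum_smult_ldistr[symmetric]) auto
    finally show ?thesis .
  qed
qed

text \<open>Both supports are finite, so this is the exchange of a finite double sum after the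
  coefficients have been moved inside and commuted.\<close>

lemma linear_extension_swap:
  assumes P: "module R P" and u: "u \<in> carrier (free_module R B)" and v: "v \<in> carrier (free_module R C)"
    and \<phi>: "\<And>p q. p \<in> B \<Longrightarrow> q \<in> C \<Longrightarrow> \<phi> p q \<in> carrier P"
  shows "linear_extension P (\<lambda>p. linear_extension P (\<phi> p) v) u
    = linear_extension P (\<lambda>q. linear_extension P (\<lambda>p. \<phi> p q) u) v"
proof -
  interpret P: module R P by fact
  let ?S = "{p. u p \<noteq> \<zero>}" and ?T = "{p. v p \<noteq> \<zero>}"
  have S: "finite ?S" "?S \<subseteq> B" "\<And>p. u p \<in> carrier R" using u by (auto simp: free_module_simps)
  have T: "finite ?T" "?T \<subseteq> C" "\<And>p. v p \<in> carrier R" using v by (auto simp: free_module_simps)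
  have c: "p \<in> ?S \<Longrightarrow> q \<in> ?T \<Longrightarrow> \<phi> p q \<in> carrier P" for p q using \<phi> S T by blast
  have "linear_extension P (\<lambda>p. linear_extension P (\<phi> p) v) u
      = (\<Oplus>\<^bsub>P\<^esub>p\<in>?S. \<Oplus>\<^bsub>P\<^esub>q\<in>?T. u p \<odot>\<^bsub>P\<^esub> (v q \<odot>\<^bsub>P\<^esub> \<phi> p q))"
    unfolding linear_extension_def using S T c
    by (intro P.finsum_cong') (auto intro!: P.finsum_smult_ldistr P.finsum_closed)
  also have "\<dots> = (\<Oplus>\<^bsub>P\<^esub>q\<in>?T. \<Oplus>\<^bsub>P\<^esub>p\<in>?S. u p \<odot>\<^bsub>P\<^esub> (v q \<odot>\<^bsub>P\<^esub> \<phi> p q))"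
    using S T c by (intro P.finsum_swap) auto
  also have "\<dots> = (\<Oplus>\<^bsub>P\<^esub>q\<in>?T. \<Oplus>\<^bsub>P\<^esub>p\<in>?S. v q \<odot>\<^bsub>P\<^esub> (u p \<odot>\<^bsub>P\<^esub> \<phi> p q))"
  proof (intro P.finsum_cong' refl)
    fix p q assume "p \<in> ?S" "q \<in> ?T"
    then show "u p \<odot>\<^bsub>P\<^esub> (v q \<odot>\<^bsub>P\<^esub> \<phi> p q) = v q \<odot>\<^bsub>P\<^esub> (u p \<odot>\<^bsub>P\<^esub> \<phi> p q)"
      using S T c by (metis P.smult_assoc1 m_comm)
  qed (use S T c in \<open>auto intro!: P.finsum_closed\<close>)
  also have "\<dots> = linear_extension P (\<lambda>q. linear_extension P (\<lambda>p. \<phi> p q) u) v"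
    unfolding linear_extension_def using S T c
    by (intro P.finsum_cong') (auto intro!: P.finsum_smult_ldistr[symmetric] P.finsum_closed)
  finally show ?thesis .
qed

end

section \<open>The tensor product\<close>

context module
begin

section \<open>Cosets of a submodule and quotient modules\<close>

lemma submodule_Inter:
  assumes "\<And>U. U \<in> \<U> \<Longrightarrow> submodule U R M" and "\<U> \<noteq> {}"
  shows "submodule (\<Inter>\<U>) R M"
proof (rule submoduleI)
  show "\<Inter>\<U> \<subseteq> carrier M" using submoduleE(1)[OF assms(1)] assms(2) by fast
  show "\<zero>\<^bsub>M\<^esub> \<in> \<Inter>\<U>"
    using assms(1) subgroup.one_closed[OF submodule.axioms(1)] by fastforce
qed (auto intro: submoduleE(3-5)[OF assms(1)])

text \<open>These facts make coset formation a linear map into the quotient; the last two control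
  the representative that \<open>tensor_lift\<close> picks from a coset.\<close>

lemma submodule_coset:
  assumes U: "submodule U R M"
  shows submodule_coset_eq_iff:
      "\<lbrakk>x \<in> carrier M; y \<in> carrier M\<rbrakk> \<Longrightarrow> U +>\<^bsub>M\<^esub> x = U +>\<^bsub>M\<^esub> y \<longleftrightarrow> x \<ominus>\<^bsub>M\<^esub> y \<in> U"
    and submodule_coset_add:
      "\<lbrakk>x \<in> carrier M; y \<in> carrier M\<rbrakk> \<Longrightarrow> (U +>\<^bsub>M\<^esub> x) <+>\<^bsub>M\<^esub> (U +>\<^bsub>M\<^esub> y) = U +>\<^bsub>M\<^esub> (x \<oplus>\<^bsub>M\<^esub> y)"
    and submodule_coset_smult:
      "\<lbrakk>a \<in> carrier R; x \<in> carrier M\<rbrakk>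
        \<Longrightarrow> (\<Union>y\<in>U +>\<^bsub>M\<^esub> x. U +>\<^bsub>M\<^esub> (a \<odot>\<^bsub>M\<^esub> y)) = U +>\<^bsub>M\<^esub> (a \<odot>\<^bsub>M\<^esub> x)"
    and submodule_coset_self: "x \<in> carrier M \<Longrightarrow> x \<in> U +>\<^bsub>M\<^esub> x"
    and submodule_coset_minus:
      "\<lbrakk>x \<in> carrier M; y \<in> U +>\<^bsub>M\<^esub> x\<rbrakk> \<Longrightarrow> y \<in> carrier M \<and> y \<ominus>\<^bsub>M\<^esub> x \<in> U"
proof -
  interpret U: abelian_subgroup U M
    using submodule.axioms(1)[OF U] M.abelian_group_axioms
    by (intro abelian_subgroupI3 additive_subgroupI)
  show self: "x \<in> U +>\<^bsub>M\<^esub> x" if "x \<in> carrier M" for x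
    using that by (rule U.a_rcos_self)
  show minus: "y \<in> carrier M \<and> y \<ominus>\<^bsub>M\<^esub> x \<in> U" if "x \<in> carrier M" "y \<in> U +>\<^bsub>M\<^esub> x" for x y
    using that U.a_rcos_module U.a_elemrcos_carrier U.a_rcos_module_minus M.abelian_group_axioms
    by (metis a_minus_def)
  show eq: "U +>\<^bsub>M\<^esub> x = U +>\<^bsub>M\<^esub> y \<longleftrightarrow> x \<ominus>\<^bsub>M\<^esub> y \<in> U" if "x \<in> carrier M" "y \<in> carrier M" for x y
  proof
    assume "x \<ominus>\<^bsub>M\<^esub> y \<in> U"
    then have "(x \<ominus>\<^bsub>M\<^esub> y) \<oplus>\<^bsub>M\<^esub> y \<in> U +>\<^bsub>M\<^esub> y"
      using that U.a_subset by (intro M.a_rcosI) auto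
    then have "x \<in> U +>\<^bsub>M\<^esub> y"
      using that by (simp add: a_minus_def M.a_assoc M.l_neg)
    then show "U +>\<^bsub>M\<^esub> x = U +>\<^bsub>M\<^esub> y"
      using that M.a_repr_independence U.a_subgroup by metis
  qed (use that self minus in blast)
  show "(U +>\<^bsub>M\<^esub> x) <+>\<^bsub>M\<^esub> (U +>\<^bsub>M\<^esub> y) = U +>\<^bsub>M\<^esub> (x \<oplus>\<^bsub>M\<^esub> y)"
    if "x \<in> carrier M" "y \<in> carrier M" for x y
    using that by (rule U.a_rcos_sum)
  show "(\<Union>y\<in>U +>\<^bsub>M\<^esub> x. U +>\<^bsub>M\<^esub> (a \<odot>\<^bsub>M\<^esub> y)) = U +>\<^bsub>M\<^esub> (a \<odot>\<^bsub>M\<^esub> x)"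
    if a: "a \<in> carrier R" and x: "x \<in> carrier M" for a x
  proof -
    have "U +>\<^bsub>M\<^esub> (a \<odot>\<^bsub>M\<^esub> y) = U +>\<^bsub>M\<^esub> (a \<odot>\<^bsub>M\<^esub> x)" if "y \<in> U +>\<^bsub>M\<^esub> x" for y
    proof -
      have y: "y \<in> carrier M" "y \<ominus>\<^bsub>M\<^esub> x \<in> U" using minus[OF x that] by auto
      then have "a \<odot>\<^bsub>M\<^esub> y \<ominus>\<^bsub>M\<^esub> a \<odot>\<^bsub>M\<^esub> x = a \<odot>\<^bsub>M\<^esub> (y \<ominus>\<^bsub>M\<^esub> x)"
        using a x by (simp add: a_minus_def smult_r_distr smult_r_minus)
      then show ?thesis using y a x by (simp add: eq submoduleE(4)[OF U])
    qed
    \<comment> \<open>A union of equal sets is that set only over a nonempty index, hence the appeal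
      to a member of the coset.\<close>
    moreover have "U +>\<^bsub>M\<^esub> x \<noteq> {}"
      using self[OF x] by blast
    ultimately show ?thesis
      by (rule SUP_eq_const[rotated])
  qed
qed

end

text \<open>Module axioms are equations, plus the existence of negatives, and both pass along a
  surjection that respects the operations. Nothing about \<open>T\<close> has to be known
  beforehand, so this fits the raw record \<open>tensor\<close>.\<close>

lemma module_surj_imageI:
  fixes T :: "('k, 'c, 'w) module_scheme"
  assumes F: "module K F" and surj: "carrier T = q ` carrier F"
    and add: "\<And>x y. x \<in> carrier F \<Longrightarrow> y \<in> carrier F \<Longrightarrow> q (x \<oplus>\<^bsub>F\<^esub> y) = q x \<oplus>\<^bsub>T\<^esub> q y"
    and smult: "\<And>a x. a \<in> carrier K \<Longrightarrow> x \<in> carrier F \<Longrightarrow> q (a \<odot>\<^bsub>F\<^esub> x) = a \<odot>\<^bsub>T\<^esub> q x"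
    and zero: "q \<zero>\<^bsub>F\<^esub> = \<zero>\<^bsub>T\<^esub>"
  shows "module K T"
proof -
  interpret F: module K F by fact
  note simps = add[symmetric] smult[symmetric] zero[symmetric]
  have c: "q x \<in> carrier T" if "x \<in> carrier F" for x using surj that by blast
  show ?thesis
  proof (rule moduleI)
    show "cring K" by (rule F.is_cring)
    show "abelian_group T"
    proof (rule abelian_groupI)
      fix t
      assume "t \<in> carrier T"
      then obtain x where x: "x \<in> carrier F" "t = q x" using surj by auto
      then have "q (\<ominus>\<^bsub>F\<^esub> x) \<oplus>\<^bsub>T\<^esub> t = \<zero>\<^bsub>T\<^esub>" by (simp add: simps F.l_neg)
      then show "\<exists>s\<in>carrier T. s \<oplus>\<^bsub>T\<^esub> t = \<zero>\<^bsub>T\<^esub>" using x surj by blast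
    qed (use c in \<open>auto simp: surj simps F.a_ac\<close>)
  qed (use c in \<open>auto simp: surj simps F.smult_l_distr F.smult_r_distr F.smult_assoc1\<close>)
qed

lemma tensor_simps:
  fixes K M N F defines "F \<equiv> free_module K (carrier M \<times> carrier N)"
  shows "carrier (tensor K M N) = a_rcosets\<^bsub>F\<^esub> (tensor_kernel K M N)"
    "\<zero>\<^bsub>tensor K M N\<^esub> = tensor_kernel K M N"
    "s \<oplus>\<^bsub>tensor K M N\<^esub> t = s <+>\<^bsub>F\<^esub> t"
    "a \<odot>\<^bsub>tensor K M N\<^esub> t = (\<Union>u\<in>t. tensor_kernel K M N +>\<^bsub>F\<^esub> (a \<odot>\<^bsub>F\<^esub> u))"
  by (simp_all add: tensor_def Let_def F_def)

context field
begin

context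
  fixes M :: "('a, 'c, 'd) module_scheme" and N :: "('a, 'e, 'f) module_scheme"
  assumes M: "module R M" and N: "module R N"
begin

interpretation M: module R M by (rule M)
interpretation N: module R N by (rule N)

private abbreviation (input) "F \<equiv> free_module R (carrier M \<times> carrier N)"
private abbreviation (input) "U \<equiv> tensor_kernel R M N"

interpretation F: module R F by (rule free_module_is_module)

lemma tensor_relatorsI:
  "\<lbrakk>x \<in> carrier M; x' \<in> carrier M; y \<in> carrier N\<rbrakk> \<Longrightarrow>
    free_basis R (x \<oplus>\<^bsub>M\<^esub> x', y) \<ominus>\<^bsub>F\<^esub> (free_basis R (x, y) \<oplus>\<^bsub>F\<^esub> free_basis R (x', y))
      \<in> tensor_relators R M N"
  "\<lbrakk>x \<in> carrier M; y \<in> carrier N; y' \<in> carrier N\<rbrakk> \<Longrightarrow>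
    free_basis R (x, y \<oplus>\<^bsub>N\<^esub> y') \<ominus>\<^bsub>F\<^esub> (free_basis R (x, y) \<oplus>\<^bsub>F\<^esub> free_basis R (x, y'))
      \<in> tensor_relators R M N"
  "\<lbrakk>a \<in> carrier R; x \<in> carrier M; y \<in> carrier N\<rbrakk> \<Longrightarrow>
    free_basis R (a \<odot>\<^bsub>M\<^esub> x, y) \<ominus>\<^bsub>F\<^esub> a \<odot>\<^bsub>F\<^esub> free_basis R (x, y) \<in> tensor_relators R M N"
  "\<lbrakk>a \<in> carrier R; x \<in> carrier M; y \<in> carrier N\<rbrakk> \<Longrightarrow>
    free_basis R (x, a \<odot>\<^bsub>N\<^esub> y) \<ominus>\<^bsub>F\<^esub> a \<odot>\<^bsub>F\<^esub> free_basis R (x, y) \<in> tensor_relators R M N"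
  unfolding tensor_relators_def Let_def
  subgoal by (rule UnI1, rule UnI1, rule UnI1, intro CollectI exI conjI) (rule refl | assumption)+
  subgoal by (rule UnI1, rule UnI1, rule UnI2, intro CollectI exI conjI) (rule refl | assumption)+
  subgoal by (rule UnI1, rule UnI2, intro CollectI exI conjI) (rule refl | assumption)+
  subgoal by (rule UnI2, intro CollectI exI conjI) (rule refl | assumption)+
  done

lemma tensor_relators_subset: "tensor_relators R M N \<subseteq> carrier F"
  unfolding tensor_relators_def Let_def
  by (rule subsetI; elim UnE CollectE exE conjE; clarify;
      intro F.minus_closed F.a_closed F.smult_closed free_basis_closed SigmaI
        M.a_closed N.a_closed M.smult_closed N.smult_closed; assumption)

text \<open>The intersection runs over a nonempty family, because the whole free module is a
  submodule containing the relators.\<close>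

lemma tensor_kernel_submodule: "submodule U R F"
  unfolding tensor_kernel_def
  by (intro F.submodule_Inter) (use tensor_relators_subset F.carrier_is_submodule in blast)+

lemma tensor_relators_kernel: "tensor_relators R M N \<subseteq> U"
  by (auto simp: tensor_kernel_def)

lemma tensor_kernel_least:
  assumes "submodule V R F" and "tensor_relators R M N \<subseteq> V"
  shows "U \<subseteq> V"
  using assms by (auto simp: tensor_kernel_def)

lemma tensor_carrier: "carrier (tensor R M N) = (\<lambda>u. U +>\<^bsub>F\<^esub> u) ` carrier F"
  by (auto simp: tensor_simps A_RCOSETS_def')

lemma tensor_is_module: "module R (tensor R M N)"
  and tensor_quotient_linear: "(\<lambda>u. U +>\<^bsub>F\<^esub> u) \<in> linear_maps R F (tensor R M N)"
proof -
  note coset = F.submodule_coset[OF tensor_kernel_submodule]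
  show "module R (tensor R M N)"
    by (rule module_surj_imageI[OF F.module_axioms tensor_carrier])
      (simp_all add: tensor_simps coset F.submoduleE(1)[OF tensor_kernel_submodule])
  show "(\<lambda>u. U +>\<^bsub>F\<^esub> u) \<in> linear_maps R F (tensor R M N)"
    by (rule linear_mapsI) (simp_all add: tensor_carrier tensor_simps(3,4) coset)
qed

text \<open>Each of the four families of relators becomes one law: additivity and homogeneity in the
  left and in the right factor.\<close>

lemma pure_tensor_bilinear: "pure_tensor R M N \<in> bilinear_maps R M N (tensor R M N)"
proof -
  let ?q = "\<lambda>u. U +>\<^bsub>F\<^esub> u"
  note q = tensor_quotient_linear
  note e = free_basis_closed[of _ "carrier M \<times> carrier N"]
  have eq: "?q u = ?q v" if "u \<ominus>\<^bsub>F\<^esub> v \<in> tensor_relators R M N" "u \<in> carrier F" "v \<in> carrier F" for u v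
    using that tensor_relators_kernel
    by (subst F.submodule_coset_eq_iff[OF tensor_kernel_submodule]) auto
  have add: "?q w = ?q u \<oplus>\<^bsub>tensor R M N\<^esub> ?q v"
    if "w \<ominus>\<^bsub>F\<^esub> (u \<oplus>\<^bsub>F\<^esub> v) \<in> tensor_relators R M N"
      "w \<in> carrier F" "u \<in> carrier F" "v \<in> carrier F" for u v w
    using eq[OF that(1,2)] that(3,4) linear_maps_add[OF q that(3,4)] by simp
  have smult: "?q w = a \<odot>\<^bsub>tensor R M N\<^esub> ?q u"
    if "w \<ominus>\<^bsub>F\<^esub> a \<odot>\<^bsub>F\<^esub> u \<in> tensor_relators R M N"
      "w \<in> carrier F" "a \<in> carrier R" "u \<in> carrier F" for a u w
    using eq[OF that(1,2)] that(3,4) linear_maps_smult[OF q that(3,4)] by simp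
  have "(\<lambda>x y. ?q (free_basis R (x, y))) \<in> bilinear_maps R M N (tensor R M N)"
  proof (intro bilinear_mapsI linear_mapsI)
    fix x y assume "x \<in> carrier M" "y \<in> carrier N"
    then show "?q (free_basis R (x, y)) \<in> carrier (tensor R M N)"
      by (intro linear_maps_closed[OF q] e) auto
    then show "?q (free_basis R (x, y)) \<in> carrier (tensor R M N)" .
  qed (rule add smult; (rule tensor_relatorsI)?;
      (assumption | rule e SigmaI M.a_closed N.a_closed M.smult_closed N.smult_closed)+)+
  then show ?thesis
    unfolding pure_tensor_def .
qed

text \<open>Composed with the quotient map, both sides are linear on the free module, and its basis
  vectors are sent to the pure tensors.\<close>

lemma tensor_linear_eqI:
  assumes P: "module R P" and f: "f \<in> linear_maps R (tensor R M N) P"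
    and g: "g \<in> linear_maps R (tensor R M N) P"
    and eq: "\<And>x y. x \<in> carrier M \<Longrightarrow> y \<in> carrier N
      \<Longrightarrow> f (pure_tensor R M N x y) = g (pure_tensor R M N x y)"
    and t: "t \<in> carrier (tensor R M N)"
  shows "f t = g t"
proof -
  obtain u where u: "u \<in> carrier F" "t = U +>\<^bsub>F\<^esub> u" using t by (auto simp: tensor_carrier)
  show ?thesis
    unfolding u(2)
    by (rule free_module_linear_eqI[OF P _ _ _ u(1)];
        (rule linear_maps_comp[OF tensor_quotient_linear] f g)?)
      (use eq f g in \<open>auto simp: pure_tensor_def\<close>)
qed

text \<open>Well-definedness of the lift. The zero set of the linear extension is a submodule,
  contains the relators because \<phi> is bilinear, and so contains \<open>tensor_kernel\<close> by
  minimality; hence every representative of a coset gives the same value.\<close>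

lemma tensor_lift_coset:
  assumes P: "module R P" and \<phi>: "\<phi> \<in> bilinear_maps R M N P" and u: "u \<in> carrier F"
  shows "tensor_lift R P \<phi> (U +>\<^bsub>F\<^esub> u) = linear_extension P (\<lambda>p. \<phi> (fst p) (snd p)) u"
proof -
  interpret P: module R P by fact
  let ?f = "linear_extension P (\<lambda>p. \<phi> (fst p) (snd p))"
  have c: "(\<lambda>p. \<phi> (fst p) (snd p)) \<in> carrier M \<times> carrier N \<rightarrow> carrier P"
    using bilinear_maps_closed[OF \<phi>] by auto
  note f = linear_extension_linear[OF P c]
  note zero = linear_maps_zero[OF F.module_axioms P f]
  note minus = linear_maps_minus[OF F.module_axioms P f]
  have basis: "?f (free_basis R (x, y)) = \<phi> x y" if "x \<in> carrier M" "y \<in> carrier N" for x y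
    using linear_extension_basis[OF P c] that by simp
  have "submodule {v \<in> carrier F. ?f v = \<zero>\<^bsub>P\<^esub>} R F"
  proof (rule F.submoduleI)
    fix v assume v: "v \<in> {v \<in> carrier F. ?f v = \<zero>\<^bsub>P\<^esub>}"
    then have "?f (\<zero>\<^bsub>F\<^esub> \<ominus>\<^bsub>F\<^esub> v) = \<zero>\<^bsub>P\<^esub>"
      using minus[OF F.zero_closed, of v] zero by (simp add: P.minus_eq)
    then show "\<ominus>\<^bsub>F\<^esub> v \<in> {v \<in> carrier F. ?f v = \<zero>\<^bsub>P\<^esub>}" using v by (simp add: a_minus_def)
  qed (auto simp: zero linear_maps_add[OF f] linear_maps_smult[OF f])
  moreover have "tensor_relators R M N \<subseteq> {v \<in> carrier F. ?f v = \<zero>\<^bsub>P\<^esub>}"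
  proof -
    \<comment> \<open>Every relator is a difference of two vectors, and bilinearity gives these two
      the same image.\<close>
    have z: "?f (v \<ominus>\<^bsub>F\<^esub> w) = \<zero>\<^bsub>P\<^esub>" if "v \<in> carrier F" "w \<in> carrier F" "?f v = ?f w" for v w
      using minus that linear_maps_closed[OF f that(2)] by (simp add: a_minus_def P.r_neg)
    note lin = linear_maps_add[OF f] linear_maps_smult[OF f] basis
      linear_mapsD[OF bilinear_maps_right[OF \<phi>]] linear_mapsD[OF bilinear_maps_left[OF \<phi>]]
    have "?f r = \<zero>\<^bsub>P\<^esub>" if "r \<in> tensor_relators R M N" for r
      using that unfolding tensor_relators_def Let_def
      by (elim UnE CollectE exE conjE; clarify; intro z; simp add: lin free_basis_closed)
    then show ?thesis
      using tensor_relators_subset by blast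
  qed
  ultimately have U: "?f v = \<zero>\<^bsub>P\<^esub>" if "v \<in> U" for v
    using tensor_kernel_least that by blast
  note coset = F.submodule_coset[OF tensor_kernel_submodule]
  \<comment> \<open>This is the representative selected in \<open>tensor_lift\<close>; it differs
    from \<open>u\<close> by an element of the kernel.\<close>
  let ?v = "SOME v. v \<in> U +>\<^bsub>F\<^esub> u"
  have "?v \<in> U +>\<^bsub>F\<^esub> u" using coset(4)[OF u] by (rule someI[of "\<lambda>v. v \<in> U +>\<^bsub>F\<^esub> u"])
  then have v: "?v \<in> carrier F" "?v \<ominus>\<^bsub>F\<^esub> u \<in> U" using coset(5)[OF u] by auto
  have "?f ?v \<ominus>\<^bsub>P\<^esub> ?f u = \<zero>\<^bsub>P\<^esub>"
    using minus[OF v(1) u] U[OF v(2)] by simp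
  moreover have "?f ?v = (?f ?v \<ominus>\<^bsub>P\<^esub> ?f u) \<oplus>\<^bsub>P\<^esub> ?f u"
    using linear_maps_closed[OF f v(1)] linear_maps_closed[OF f u]
    by (simp only: P.minus_eq P.a_assoc P.l_neg P.r_zero P.a_inv_closed)
  ultimately have "?f ?v = ?f u"
    using P.l_zero[OF linear_maps_closed[OF f u]] by (simp only:)
  then show ?thesis
    unfolding tensor_lift_def Let_def linear_extension_def[symmetric] .
qed

lemma tensor_lift_linear:
  assumes P: "module R P" and \<phi>: "\<phi> \<in> bilinear_maps R M N P"
  shows "tensor_lift R P \<phi> \<in> linear_maps R (tensor R M N) P"
proof -
  let ?q = "\<lambda>u. U +>\<^bsub>F\<^esub> u"
  have "(\<lambda>p. \<phi> (fst p) (snd p)) \<in> carrier M \<times> carrier N \<rightarrow> carrier P"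
    using bilinear_maps_closed[OF \<phi>] by auto
  note f = linear_mapsD[OF linear_extension_linear[OF P this]]
  note q = linear_mapsD(2,3)[OF tensor_quotient_linear, symmetric]
  show ?thesis
    by (rule linear_mapsI) (auto simp: tensor_carrier q tensor_lift_coset[OF P \<phi>] f)
qed

lemma tensor_lift_pure:
  assumes P: "module R P" and \<phi>: "\<phi> \<in> bilinear_maps R M N P"
    and x: "x \<in> carrier M" and y: "y \<in> carrier N"
  shows "tensor_lift R P \<phi> (pure_tensor R M N x y) = \<phi> x y"
proof -
  have c: "(\<lambda>p. \<phi> (fst p) (snd p)) \<in> carrier M \<times> carrier N \<rightarrow> carrier P"
    using bilinear_maps_closed[OF \<phi>] by auto
  have b: "(x, y) \<in> carrier M \<times> carrier N" using x y by auto
  show ?thesis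
    by (simp add: pure_tensor_def tensor_lift_coset[OF P \<phi> free_basis_closed[OF b]]
        linear_extension_basis[OF P c b])
qed

text \<open>
  By definition \<^const>\<open>tensor_lift\<close> evaluates at a representative that depends on the tensor only,
  which makes the following rules available for maps that are not bilinear.
\<close>

lemma tensor_representative:
  assumes t: "t \<in> carrier (tensor R M N)"
  shows "(SOME u. u \<in> t) \<in> carrier (free_module R (carrier M \<times> carrier N))"
proof -
  obtain u where u: "u \<in> carrier F" "t = U +>\<^bsub>F\<^esub> u" using t by (auto simp: tensor_carrier)
  have "(SOME v. v \<in> t) \<in> U +>\<^bsub>F\<^esub> u"
    unfolding u(2) using F.submodule_coset(4)[OF tensor_kernel_submodule u(1)]
    by (rule someI[of "\<lambda>v. v \<in> U +>\<^bsub>F\<^esub> u"])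
  then show ?thesis
    using F.submodule_coset(5)[OF tensor_kernel_submodule u(1)] by auto
qed

end

lemma tensor_lift_eq_linear_extension:
  "tensor_lift R P \<phi> t = linear_extension P (\<lambda>p. \<phi> (fst p) (snd p)) (SOME u. u \<in> t)"
  by (simp add: tensor_lift_def linear_extension_def Let_def)

end

section \<open>Sweedler calculus\<close>

text \<open>Rules that establish linearity in one variable by recursion over a term. Together with
  \<open>linear_maps_id\<close> they discharge the hypotheses of the Sweedler rules.\<close>

named_theorems linear_intros

context field
begin

section \<open>Sums over the representative of a fixed tensor\<close>

lemma tensor_lift_comp:
  assumes "module R M" and "module R N" and "module R P" and "module R Q" and f: "f \<in> linear_maps R P Q"
    and \<phi>: "\<And>x y. x \<in> carrier M \<Longrightarrow> y \<in> carrier N \<Longrightarrow> \<phi> x y \<in> carrier P"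
    and t: "t \<in> carrier (tensor R M N)"
  shows "f (tensor_lift R P \<phi> t) = tensor_lift R Q (\<lambda>x y. f (\<phi> x y)) t"
  unfolding tensor_lift_eq_linear_extension
  by (rule linear_extension_comp[OF assms(3,4) f _ tensor_representative[OF assms(1,2) t]])
    (use \<phi> in auto)

lemma tensor_lift_cong:
  assumes "module R M" and "module R N" and "module R P" and t: "t \<in> carrier (tensor R M N)"
    and "\<And>x y. x \<in> carrier M \<Longrightarrow> y \<in> carrier N \<Longrightarrow> \<phi> x y \<in> carrier P"
    and "\<And>x y. x \<in> carrier M \<Longrightarrow> y \<in> carrier N \<Longrightarrow> \<phi> x y = \<psi> x y"
  shows "tensor_lift R P \<phi> t = tensor_lift R P \<psi> t"
  unfolding tensor_lift_eq_linear_extension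
  by (rule linear_extension_cong[OF assms(3) tensor_representative[OF assms(1,2) t]])
    (use assms(5,6) in auto)

lemma tensor_lift_closed:
  assumes "module R M" and "module R N" and "module R P" and t: "t \<in> carrier (tensor R M N)"
    and "\<And>x y. x \<in> carrier M \<Longrightarrow> y \<in> carrier N \<Longrightarrow> \<phi> x y \<in> carrier P"
  shows "tensor_lift R P \<phi> t \<in> carrier P"
  unfolding tensor_lift_eq_linear_extension
  by (rule linear_maps_closed[OF linear_extension_linear[OF assms(3)]
        tensor_representative[OF assms(1,2) t]])
    (use assms(5) in auto)

lemma tensor_lift_linear_arg:
  assumes "module R M" and "module R N" and "module R P" and "module R V"
    and t: "t \<in> carrier (tensor R M N)"
    and "\<And>x y. x \<in> carrier M \<Longrightarrow> y \<in> carrier N \<Longrightarrow> (\<lambda>v. \<phi> v x y) \<in> linear_maps R V P"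
  shows "(\<lambda>v. tensor_lift R P (\<phi> v) t) \<in> linear_maps R V P"
  unfolding tensor_lift_eq_linear_extension
  by (rule linear_extension_linear_arg[OF assms(3,4) tensor_representative[OF assms(1,2) t]])
    (use assms(6) in auto)

lemma tensor_lift_swap:
  assumes "module R M" and "module R N" and s: "s \<in> carrier (tensor R M N)"
    and "module R M'" and "module R N'" and t: "t \<in> carrier (tensor R M' N')" and P: "module R P"
    and \<phi>: "\<And>x y x' y'. \<lbrakk>x \<in> carrier M; y \<in> carrier N; x' \<in> carrier M'; y' \<in> carrier N'\<rbrakk>
      \<Longrightarrow> \<phi> x y x' y' \<in> carrier P"
  shows "tensor_lift R P (\<lambda>x y. tensor_lift R P (\<phi> x y) t) s
    = tensor_lift R P (\<lambda>x' y'. tensor_lift R P (\<lambda>x y. \<phi> x y x' y') s) t"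
  unfolding tensor_lift_eq_linear_extension
  by (rule linear_extension_swap[OF P tensor_representative[OF assms(1,2) s]
        tensor_representative[OF assms(4,5) t]])
    (use \<phi> in auto)

end

lemma (in module) smult_linear_maps [linear_intros]:
  "\<lbrakk>a \<in> carrier R; f \<in> linear_maps R V M\<rbrakk> \<Longrightarrow> (\<lambda>x. a \<odot>\<^bsub>M\<^esub> f x) \<in> linear_maps R V M"
  by (rule linear_mapsI)
    (simp_all add: linear_mapsD smult_r_distr smult_assoc1[symmetric] R.m_comm)

context hopf_algebra
begin

lemma module_H [simp, intro]: "module K H"
  by (rule module_axioms)

lemma counit_closed [simp, intro]: "h \<in> carrier H \<Longrightarrow> counit H h \<in> carrier K"
  by (rule ring_hom_closed[OF counit_hom])

lemma antipode_closed [simp, intro]: "h \<in> carrier H \<Longrightarrow> antipode H h \<in> carrier H"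
  by (rule linear_maps_closed[OF antipode_linear])

lemma comult_closed: "h \<in> carrier H \<Longrightarrow> comult H h \<in> carrier (tensor K H H)"
  by (rule linear_maps_closed[OF comult_linear])

lemma counit_mult: "\<lbrakk>g \<in> carrier H; h \<in> carrier H\<rbrakk>
    \<Longrightarrow> counit H (g \<otimes>\<^bsub>H\<^esub> h) = counit H g \<otimes>\<^bsub>K\<^esub> counit H h"
  by (rule ring_hom_mult[OF counit_hom])

lemma linear_maps_mult_left [linear_intros]:
  "\<lbrakk>f \<in> linear_maps K V H; b \<in> carrier H\<rbrakk> \<Longrightarrow> (\<lambda>x. f x \<otimes>\<^bsub>H\<^esub> b) \<in> linear_maps K V H"
  by (rule linear_mapsI) (simp_all add: linear_mapsD l_distr smult_mult_left)

lemma linear_maps_mult_right [linear_intros]: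
  "\<lbrakk>f \<in> linear_maps K V H; b \<in> carrier H\<rbrakk> \<Longrightarrow> (\<lambda>x. b \<otimes>\<^bsub>H\<^esub> f x) \<in> linear_maps K V H"
  by (rule linear_mapsI) (simp_all add: linear_mapsD r_distr smult_mult_right)

lemma linear_maps_antipode [linear_intros]:
  "f \<in> linear_maps K V H \<Longrightarrow> (\<lambda>x. antipode H (f x)) \<in> linear_maps K V H"
  by (rule linear_maps_comp[OF _ antipode_linear])

lemma linear_maps_counit_smult [linear_intros]:
  assumes "f \<in> linear_maps K V H" and "module K P" and "p \<in> carrier P"
  shows "(\<lambda>x. counit H (f x) \<odot>\<^bsub>P\<^esub> p) \<in> linear_maps K V P"
proof -
  interpret P: module K P by fact
  show ?thesis
    using assms(1,3)
    by (intro linear_mapsI)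
      (simp_all add: linear_mapsD ring_hom_add[OF counit_hom] counit_smult P.smult_l_distr P.smult_assoc1)
qed

lemma sweedler_closed [intro, simp]:
  assumes "module K P" and "h \<in> carrier H"
    and "\<And>a b. a \<in> carrier H \<Longrightarrow> b \<in> carrier H \<Longrightarrow> \<phi> a b \<in> carrier P"
  shows "sweedler K H P \<phi> h \<in> carrier P"
  unfolding sweedler_def
  by (rule tensor_lift_closed[OF module_H module_H assms(1) comult_closed[OF assms(2)] assms(3)])

lemma sweedler_cong:
  assumes "module K P" and "h \<in> carrier H"
    and "\<And>a b. a \<in> carrier H \<Longrightarrow> b \<in> carrier H \<Longrightarrow> \<phi> a b \<in> carrier P"
    and "\<And>a b. a \<in> carrier H \<Longrightarrow> b \<in> carrier H \<Longrightarrow> \<phi> a b = \<psi> a b"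
  shows "sweedler K H P \<phi> h = sweedler K H P \<psi> h"
  unfolding sweedler_def
  by (rule tensor_lift_cong[OF module_H module_H assms(1) comult_closed[OF assms(2)] assms(3,4)])

lemma sweedler_comp:
  assumes "module K P" and "module K Q" and "f \<in> linear_maps K P Q" and "h \<in> carrier H"
    and "\<And>a b. a \<in> carrier H \<Longrightarrow> b \<in> carrier H \<Longrightarrow> \<phi> a b \<in> carrier P"
  shows "f (sweedler K H P \<phi> h) = sweedler K H Q (\<lambda>a b. f (\<phi> a b)) h"
  unfolding sweedler_def
  by (rule tensor_lift_comp[OF module_H module_H assms(1,2,3,5) comult_closed[OF assms(4)]])

lemma sweedler_swap:
  assumes "module K P" and "g \<in> carrier H" and "h \<in> carrier H"
    and "\<And>a b c d. \<lbrakk>a \<in> carrier H; b \<in> carrier H; c \<in> carrier H; d \<in> carrier H\<rbrakk>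
      \<Longrightarrow> \<phi> a b c d \<in> carrier P"
  shows "sweedler K H P (\<lambda>a b. sweedler K H P (\<phi> a b) h) g
    = sweedler K H P (\<lambda>c d. sweedler K H P (\<lambda>a b. \<phi> a b c d) g) h"
  unfolding sweedler_def
  by (rule tensor_lift_swap[OF module_H module_H comult_closed[OF assms(2)]
        module_H module_H comult_closed[OF assms(3)] assms(1,4)])

lemma linear_maps_sweedler_arg [linear_intros]:
  assumes "module K P" and "module K V" and "h \<in> carrier H"
    and "\<And>a b. a \<in> carrier H \<Longrightarrow> b \<in> carrier H \<Longrightarrow> (\<lambda>v. \<phi> v a b) \<in> linear_maps K V P"
  shows "(\<lambda>v. sweedler K H P (\<phi> v) h) \<in> linear_maps K V P"
  unfolding sweedler_def
  by (rule tensor_lift_linear_arg[OF module_H module_H assms(1,2) comult_closed[OF assms(3)] assms(4)])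

text \<open>The variable sits inside \<open>comult\<close>, so its values involve different tensors
  with unrelated representatives; bilinearity of \<phi> removes the dependence on them. In
  \<open>linear_maps_sweedler_arg\<close> the tensor is fixed and the summand varies.\<close>

lemma linear_maps_sweedler [linear_intros]:
  assumes "module K P" and "f \<in> linear_maps K V H"
    and "\<And>a. a \<in> carrier H \<Longrightarrow> (\<lambda>b. \<phi> a b) \<in> linear_maps K H P"
    and "\<And>b. b \<in> carrier H \<Longrightarrow> (\<lambda>a. \<phi> a b) \<in> linear_maps K H P"
  shows "(\<lambda>v. sweedler K H P \<phi> (f v)) \<in> linear_maps K V P"
  unfolding sweedler_def
  by (rule linear_maps_comp[OF linear_maps_comp[OF assms(2) comult_linear]
        tensor_lift_linear[OF module_H module_H assms(1) bilinear_mapsI[OF assms(3,4)]]])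

text \<open>The image under \<open>f\<close> of the counit axiom, which is an equation in
  \<open>H\<close>; with values in \<open>P\<close> it can be applied inside longer
  expressions.\<close>

lemma sweedler_counit_left:
  assumes "module K P" and "f \<in> linear_maps K H P" and "h \<in> carrier H"
  shows "sweedler K H P (\<lambda>a b. counit H a \<odot>\<^bsub>P\<^esub> f b) h = f h"
proof -
  interpret P: module K P by fact
  have "f h = sweedler K H P (\<lambda>a b. f (counit H a \<odot>\<^bsub>H\<^esub> b)) h"
    using assms sweedler_comp[OF module_H assms(1,2,3), of "\<lambda>a b. counit H a \<odot>\<^bsub>H\<^esub> b"]
    by (simp add: counit_left)
  also have "\<dots> = sweedler K H P (\<lambda>a b. counit H a \<odot>\<^bsub>P\<^esub> f b) h"
    using assms by (intro sweedler_cong) (simp_all add: linear_mapsD)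
  finally show ?thesis by simp
qed

lemma sweedler_counit_right:
  assumes "module K P" and "f \<in> linear_maps K H P" and "h \<in> carrier H"
  shows "sweedler K H P (\<lambda>a b. counit H b \<odot>\<^bsub>P\<^esub> f a) h = f h"
proof -
  interpret P: module K P by fact
  have "f h = sweedler K H P (\<lambda>a b. f (counit H b \<odot>\<^bsub>H\<^esub> a)) h"
    using assms sweedler_comp[OF module_H assms(1,2,3), of "\<lambda>a b. counit H b \<odot>\<^bsub>H\<^esub> a"]
    by (simp add: counit_right)
  also have "\<dots> = sweedler K H P (\<lambda>a b. counit H b \<odot>\<^bsub>P\<^esub> f a) h"
    using assms by (intro sweedler_cong) (simp_all add: linear_mapsD)
  finally show ?thesis by simp
qed

lemma sweedler_antipode_left:
  assumes "module K P" and f: "f \<in> linear_maps K H P" and "h \<in> carrier H"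
  shows "sweedler K H P (\<lambda>a b. f (antipode H a \<otimes>\<^bsub>H\<^esub> b)) h = counit H h \<odot>\<^bsub>P\<^esub> f \<one>\<^bsub>H\<^esub>"
  using assms sweedler_comp[OF module_H assms, of "\<lambda>a b. antipode H a \<otimes>\<^bsub>H\<^esub> b"]
  by (simp add: antipode_left linear_maps_smult[OF f])

lemma sweedler_antipode_right:
  assumes "module K P" and f: "f \<in> linear_maps K H P" and "h \<in> carrier H"
  shows "sweedler K H P (\<lambda>a b. f (a \<otimes>\<^bsub>H\<^esub> antipode H b)) h = counit H h \<odot>\<^bsub>P\<^esub> f \<one>\<^bsub>H\<^esub>"
  using assms sweedler_comp[OF module_H assms, of "\<lambda>a b. a \<otimes>\<^bsub>H\<^esub> antipode H b"]
  by (simp add: antipode_right linear_maps_smult[OF f])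

lemma sweedler_one:
  assumes "module K P" and "\<phi> \<in> bilinear_maps K H H P"
  shows "sweedler K H P \<phi> \<one>\<^bsub>H\<^esub> = \<phi> \<one>\<^bsub>H\<^esub> \<one>\<^bsub>H\<^esub>"
  unfolding sweedler_def comult_one
  by (rule tensor_lift_pure[OF module_H module_H assms]) auto

text \<open>Bilinearity turns \<phi> into a linear map on the tensor square of \<open>H\<close>.
  Applied to \<open>comult_mult\<close>, this map passes through both sums and evaluates the pure
  tensors.\<close>

lemma sweedler_mult:
  assumes P: "module K P" and \<phi>: "\<phi> \<in> bilinear_maps K H H P" and g: "g \<in> carrier H" and h: "h \<in> carrier H"
  shows "sweedler K H P \<phi> (g \<otimes>\<^bsub>H\<^esub> h)
    = sweedler K H P (\<lambda>a b. sweedler K H P (\<lambda>c d. \<phi> (a \<otimes>\<^bsub>H\<^esub> c) (b \<otimes>\<^bsub>H\<^esub> d)) h) g"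
proof -
  have T: "module K (tensor K H H)" by (rule tensor_is_module[OF module_H module_H])
  note lift = tensor_lift_linear[OF module_H module_H P \<phi>]
  note pure = bilinear_maps_closed[OF pure_tensor_bilinear[OF module_H module_H]]
  have "sweedler K H P \<phi> (g \<otimes>\<^bsub>H\<^esub> h) = tensor_lift K P \<phi> (sweedler K H (tensor K H H)
          (\<lambda>a b. sweedler K H (tensor K H H)
             (\<lambda>c d. pure_tensor K H H (a \<otimes>\<^bsub>H\<^esub> c) (b \<otimes>\<^bsub>H\<^esub> d)) h) g)"
    unfolding sweedler_def[of K H P \<phi>] comult_mult[OF g h] ..
  also have "\<dots> = sweedler K H P (\<lambda>a b. tensor_lift K P \<phi> (sweedler K H (tensor K H H)
             (\<lambda>c d. pure_tensor K H H (a \<otimes>\<^bsub>H\<^esub> c) (b \<otimes>\<^bsub>H\<^esub> d)) h)) g"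
    using g h pure by (intro sweedler_comp[OF T P lift]) (auto intro!: sweedler_closed T)
  also have "\<dots> = sweedler K H P (\<lambda>a b. sweedler K H P
             (\<lambda>c d. tensor_lift K P \<phi> (pure_tensor K H H (a \<otimes>\<^bsub>H\<^esub> c) (b \<otimes>\<^bsub>H\<^esub> d))) h) g"
    using g h pure
    by (intro sweedler_cong[OF P] sweedler_comp[OF T P lift])
      (auto intro!: sweedler_closed T linear_maps_closed[OF lift])
  also have "\<dots> = sweedler K H P (\<lambda>a b. sweedler K H P (\<lambda>c d. \<phi> (a \<otimes>\<^bsub>H\<^esub> c) (b \<otimes>\<^bsub>H\<^esub> d)) h) g"
    using g h pure P
    by (intro sweedler_cong[OF P] tensor_lift_pure[OF module_H module_H P \<phi>])
      (auto intro!: sweedler_closed linear_maps_closed[OF lift])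
  finally show ?thesis .
qed

text \<open>A trilinear \<psi> induces a linear map on the right-bracketed triple tensor product,
  where the axiom \<open>coassoc\<close> lives. The equation is the image of that axiom.\<close>

lemma sweedler_coassoc:
  assumes P: "module K P" and h: "h \<in> carrier H"
    and lin: "\<And>b c. b \<in> carrier H \<Longrightarrow> c \<in> carrier H \<Longrightarrow> (\<lambda>a. \<psi> a b c) \<in> linear_maps K H P"
      "\<And>a c. a \<in> carrier H \<Longrightarrow> c \<in> carrier H \<Longrightarrow> (\<lambda>b. \<psi> a b c) \<in> linear_maps K H P"
      "\<And>a b. a \<in> carrier H \<Longrightarrow> b \<in> carrier H \<Longrightarrow> (\<lambda>c. \<psi> a b c) \<in> linear_maps K H P"
  shows "sweedler K H P (\<lambda>a c. sweedler K H P (\<lambda>a\<^sub>1 a\<^sub>2. \<psi> a\<^sub>1 a\<^sub>2 c) a) h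
    = sweedler K H P (\<lambda>a c. sweedler K H P (\<lambda>c\<^sub>1 c\<^sub>2. \<psi> a c\<^sub>1 c\<^sub>2) c) h"
proof -
  let ?T = "tensor K H H" and ?p = "pure_tensor K H H"
  let ?TT = "tensor K H ?T" and ?pp = "pure_tensor K H (tensor K H H)"
  have T: "module K ?T" by (rule tensor_is_module[OF module_H module_H])
  have TT: "module K ?TT" by (rule tensor_is_module[OF module_H T])
  have \<psi>: "\<psi> a \<in> bilinear_maps K H H P" if "a \<in> carrier H" for a
    using lin that by (intro bilinear_mapsI)
  note closed = bilinear_maps_closed[OF \<psi>]
  have lift: "(\<lambda>a t. tensor_lift K P (\<psi> a) t) \<in> bilinear_maps K H ?T P"
    using lin
    by (intro bilinear_mapsI tensor_lift_linear[OF module_H module_H P \<psi>]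
        tensor_lift_linear_arg[OF module_H module_H P module_H])
  \<comment> \<open>The map induced by \<psi>, built as a lift whose second argument is itself
    lifted.\<close>
  let ?f = "tensor_lift K P (\<lambda>a t. tensor_lift K P (\<psi> a) t)"
  note f = tensor_lift_linear[OF module_H T P lift]
  note p = bilinear_maps_closed[OF pure_tensor_bilinear[OF module_H module_H]]
  note pp = bilinear_maps_closed[OF pure_tensor_bilinear[OF module_H T]]
  have f_pp: "?f (?pp a t) = tensor_lift K P (\<psi> a) t" if "a \<in> carrier H" "t \<in> carrier ?T" for a t
    using that by (rule tensor_lift_pure[OF module_H T P lift])
  have "sweedler K H P (\<lambda>a c. sweedler K H P (\<lambda>a\<^sub>1 a\<^sub>2. \<psi> a\<^sub>1 a\<^sub>2 c) a) h
      = sweedler K H P (\<lambda>a c. sweedler K H P (\<lambda>a\<^sub>1 a\<^sub>2. ?f (?pp a\<^sub>1 (?p a\<^sub>2 c))) a) h"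
    using h P closed
    by (intro sweedler_cong[OF P])
      (auto intro!: sweedler_closed simp: f_pp p tensor_lift_pure[OF module_H module_H P \<psi>])
  also have "\<dots> = sweedler K H P (\<lambda>a c. ?f (sweedler K H ?TT (\<lambda>a\<^sub>1 a\<^sub>2. ?pp a\<^sub>1 (?p a\<^sub>2 c)) a)) h"
    using h P pp p
    by (intro sweedler_cong[OF P] sweedler_comp[OF TT P f, symmetric])
      (auto intro!: sweedler_closed linear_maps_closed[OF f])
  also have "\<dots> = ?f (sweedler K H ?TT (\<lambda>a c. sweedler K H ?TT (\<lambda>a\<^sub>1 a\<^sub>2. ?pp a\<^sub>1 (?p a\<^sub>2 c)) a) h)"
    using h P pp p TT
    by (intro sweedler_comp[OF TT P f, symmetric]) (auto intro!: sweedler_closed)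
  also have "\<dots> = ?f (sweedler K H ?TT (\<lambda>a c. ?pp a (comult H c)) h)"
    by (simp only: coassoc[OF h])
  also have "\<dots> = sweedler K H P (\<lambda>a c. ?f (?pp a (comult H c))) h"
    using h pp comult_closed by (intro sweedler_comp[OF TT P f]) auto
  also have "\<dots> = sweedler K H P (\<lambda>a c. sweedler K H P (\<lambda>c\<^sub>1 c\<^sub>2. \<psi> a c\<^sub>1 c\<^sub>2) c) h"
    using h pp comult_closed
    by (intro sweedler_cong[OF P])
      (auto intro!: linear_maps_closed[OF tensor_lift_linear[OF module_H module_H P \<psi>]]
        simp: f_pp sweedler_def)
  finally show ?thesis .
qed

text \<open>A neighbouring pair S(h_1) h_2 or h_1 S(h_2) contributes a counit times 1, and the
  counit law then absorbs the counit into the remaining factor.\<close>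

lemma sweedler_cancel:
  assumes P: "module K P" and h: "h \<in> carrier H"
    and lin: "\<And>b. b \<in> carrier H \<Longrightarrow> (\<lambda>a. \<psi> a b) \<in> linear_maps K H P"
      "\<And>a. a \<in> carrier H \<Longrightarrow> (\<lambda>b. \<psi> a b) \<in> linear_maps K H P"
  shows sweedler_cancel_left_antipode:
      "sweedler K H P (\<lambda>a c. sweedler K H P (\<lambda>a\<^sub>1 a\<^sub>2. \<psi> (antipode H a\<^sub>1 \<otimes>\<^bsub>H\<^esub> a\<^sub>2) c) a) h = \<psi> \<one>\<^bsub>H\<^esub> h"
    and sweedler_cancel_left_antipode':
      "sweedler K H P (\<lambda>a c. sweedler K H P (\<lambda>a\<^sub>1 a\<^sub>2. \<psi> (a\<^sub>1 \<otimes>\<^bsub>H\<^esub> antipode H a\<^sub>2) c) a) h = \<psi> \<one>\<^bsub>H\<^esub> h"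
    and sweedler_cancel_right_antipode:
      "sweedler K H P (\<lambda>a c. sweedler K H P (\<lambda>c\<^sub>1 c\<^sub>2. \<psi> a (antipode H c\<^sub>1 \<otimes>\<^bsub>H\<^esub> c\<^sub>2)) c) h = \<psi> h \<one>\<^bsub>H\<^esub>"
    and sweedler_cancel_right_antipode':
      "sweedler K H P (\<lambda>a c. sweedler K H P (\<lambda>c\<^sub>1 c\<^sub>2. \<psi> a (c\<^sub>1 \<otimes>\<^bsub>H\<^esub> antipode H c\<^sub>2)) c) h = \<psi> h \<one>\<^bsub>H\<^esub>"
proof -
  interpret P: module K P by fact
  have closed: "\<psi> a b \<in> carrier P" if "a \<in> carrier H" "b \<in> carrier H" for a b
    using linear_maps_closed[OF lin(2)] that by auto
  have one: "\<one>\<^bsub>H\<^esub> \<in> carrier H" by simp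
  note left = sweedler_counit_left[OF P lin(2)[OF one] h]
  note right = sweedler_counit_right[OF P lin(1)[OF one] h]
  show "sweedler K H P (\<lambda>a c. sweedler K H P (\<lambda>a\<^sub>1 a\<^sub>2. \<psi> (antipode H a\<^sub>1 \<otimes>\<^bsub>H\<^esub> a\<^sub>2) c) a) h = \<psi> \<one>\<^bsub>H\<^esub> h"
    unfolding left[symmetric] using P h closed
    by (intro sweedler_cong sweedler_antipode_left lin(1)) auto
  show "sweedler K H P (\<lambda>a c. sweedler K H P (\<lambda>a\<^sub>1 a\<^sub>2. \<psi> (a\<^sub>1 \<otimes>\<^bsub>H\<^esub> antipode H a\<^sub>2) c) a) h = \<psi> \<one>\<^bsub>H\<^esub> h"
    unfolding left[symmetric] using P h closed
    by (intro sweedler_cong sweedler_antipode_right lin(1)) auto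
  show "sweedler K H P (\<lambda>a c. sweedler K H P (\<lambda>c\<^sub>1 c\<^sub>2. \<psi> a (antipode H c\<^sub>1 \<otimes>\<^bsub>H\<^esub> c\<^sub>2)) c) h = \<psi> h \<one>\<^bsub>H\<^esub>"
    unfolding right[symmetric] using P h closed
    by (intro sweedler_cong sweedler_antipode_left lin(2)) auto
  show "sweedler K H P (\<lambda>a c. sweedler K H P (\<lambda>c\<^sub>1 c\<^sub>2. \<psi> a (c\<^sub>1 \<otimes>\<^bsub>H\<^esub> antipode H c\<^sub>2)) c) h = \<psi> h \<one>\<^bsub>H\<^esub>"
    unfolding right[symmetric] using P h closed
    by (intro sweedler_cong sweedler_antipode_right lin(2)) auto
qed

text \<open>In fourfold notation, \<Sum> \<psi>(h_1, h_2 S(h_3), h_4) = \<Sum> \<psi>(h_1, 1, h_2).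
  The bracketing, with both halves of \<Delta>(h) expanded independently, is the one produced by
  moving a morphism past two antipode actions in turn.\<close>

lemma sweedler_cancel_middle:
  assumes P: "module K P" and h: "h \<in> carrier H"
    and lin: "\<And>b c. b \<in> carrier H \<Longrightarrow> c \<in> carrier H \<Longrightarrow> (\<lambda>a. \<psi> a b c) \<in> linear_maps K H P"
      "\<And>a c. a \<in> carrier H \<Longrightarrow> c \<in> carrier H \<Longrightarrow> (\<lambda>b. \<psi> a b c) \<in> linear_maps K H P"
      "\<And>a b. a \<in> carrier H \<Longrightarrow> b \<in> carrier H \<Longrightarrow> (\<lambda>c. \<psi> a b c) \<in> linear_maps K H P"
  shows "sweedler K H P (\<lambda>h\<^sub>1 h\<^sub>2. sweedler K H P (\<lambda>c d.
      sweedler K H P (\<lambda>a b. \<psi> a (b \<otimes>\<^bsub>H\<^esub> antipode H c) d) h\<^sub>1) h\<^sub>2) h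
    = sweedler K H P (\<lambda>a d. \<psi> a \<one>\<^bsub>H\<^esub> d) h"
proof -
  let ?s = "sweedler K H P" and ?S = "antipode H"
  let ?\<chi> = "\<lambda>a b c d. \<psi> a (b \<otimes>\<^bsub>H\<^esub> ?S c) d"
  have closed: "\<psi> a b c \<in> carrier P" if "a \<in> carrier H" "b \<in> carrier H" "c \<in> carrier H" for a b c
    using linear_maps_closed[OF lin(3)] that by auto
  have mid: "(\<lambda>x. \<psi> a (f x) c) \<in> linear_maps K H P"
    if "f \<in> linear_maps K H H" "a \<in> carrier H" "c \<in> carrier H" for f a c
    using linear_maps_comp[OF that(1) lin(2)[OF that(2,3)]] .
  note intros = module_H P mid lin linear_intros linear_maps_id sweedler_closed closed
  have "?s (\<lambda>h\<^sub>1 h\<^sub>2. ?s (\<lambda>c d. ?s (\<lambda>a b. ?\<chi> a b c d) h\<^sub>1) h\<^sub>2) h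
      = ?s (\<lambda>h\<^sub>1 h\<^sub>2. ?s (\<lambda>a b. ?s (\<lambda>c d. ?\<chi> a b c d) h\<^sub>2) h\<^sub>1) h"
    using h by (intro sweedler_cong sweedler_swap sweedler_closed P closed) simp_all
  \<comment> \<open>Two applications of coassociativity follow: the first takes \<open>b\<close> out
    of the left half, the second groups it with \<open>c\<close>, so that the antipode identity sees
    an adjacent pair.\<close>
  also have "\<dots> = ?s (\<lambda>a h\<^sub>2. ?s (\<lambda>b h\<^sub>2\<^sub>2. ?s (\<lambda>c d. ?\<chi> a b c d) h\<^sub>2\<^sub>2) h\<^sub>2) h"
    using h by (intro sweedler_coassoc intros) simp_all
  also have "\<dots> = ?s (\<lambda>a h\<^sub>2. ?s (\<lambda>h\<^sub>2\<^sub>1 d. ?s (\<lambda>b c. ?\<chi> a b c d) h\<^sub>2\<^sub>1) h\<^sub>2) h"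
    using h by (intro sweedler_cong sweedler_coassoc[symmetric] intros) simp_all
  also have "\<dots> = ?s (\<lambda>a d. \<psi> a \<one>\<^bsub>H\<^esub> d) h"
    using h by (intro sweedler_cong sweedler_cancel_left_antipode' intros) simp_all
  finally show ?thesis .
qed

text \<open>Since \<Delta>(1) is the pure tensor of 1 with itself, the antipode axiom at 1 has the
  single summand S(1) 1.\<close>

lemma antipode_one: "antipode H \<one>\<^bsub>H\<^esub> = \<one>\<^bsub>H\<^esub>"
proof -
  have "sweedler K H H (\<lambda>a b. antipode H a \<otimes>\<^bsub>H\<^esub> b) \<one>\<^bsub>H\<^esub> = antipode H \<one>\<^bsub>H\<^esub> \<otimes>\<^bsub>H\<^esub> \<one>\<^bsub>H\<^esub>"
    by (rule sweedler_one)
      (intro module_H bilinear_mapsI linear_intros linear_maps_id antipode_closed; assumption)+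
  then show ?thesis
    using antipode_left[of "\<one>\<^bsub>H\<^esub>"] ring_hom_one[OF counit_hom] by simp
qed

text \<open>
  Both \<open>S (g h)\<close> and \<open>S h S g\<close> are convolution inverses of \<open>(g, h) \<mapsto> g h\<close>.
\<close>

lemma antipode_mult:
  assumes g: "g \<in> carrier H" and h: "h \<in> carrier H"
  shows "antipode H (g \<otimes>\<^bsub>H\<^esub> h) = antipode H h \<otimes>\<^bsub>H\<^esub> antipode H g"
proof -
  let ?s = "sweedler K H H" and ?S = "antipode H"
  \<comment> \<open>The summand of the triple convolution product: \<open>a\<close>,
    \<open>b\<close>, \<open>c\<close> are the parts of \<open>g\<close> and \<open>x\<close>,
    \<open>y\<close>, \<open>z\<close> those of \<open>h\<close>. Evaluating it with either
    bracketing gives one of the two inverses.\<close>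
  let ?\<psi> = "\<lambda>a b c x y z. ?S (a \<otimes>\<^bsub>H\<^esub> x) \<otimes>\<^bsub>H\<^esub> ((b \<otimes>\<^bsub>H\<^esub> y) \<otimes>\<^bsub>H\<^esub> (?S z \<otimes>\<^bsub>H\<^esub> ?S c))"
  note intros = module_H linear_intros linear_maps_id sweedler_closed
  \<comment> \<open>S(h) S(g) is a right inverse: the inner pair for \<open>h\<close> collapses
    first and leaves a pair for \<open>g\<close>.\<close>
  have right: "?s (\<lambda>b c. ?s (\<lambda>y z. (b \<otimes>\<^bsub>H\<^esub> y) \<otimes>\<^bsub>H\<^esub> (?S z \<otimes>\<^bsub>H\<^esub> ?S c)) h) g
      = counit H g \<odot>\<^bsub>H\<^esub> (counit H h \<odot>\<^bsub>H\<^esub> \<one>\<^bsub>H\<^esub>)" if g: "g \<in> carrier H" and h: "h \<in> carrier H" for g h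
  proof -
    have "?s (\<lambda>y z. (b \<otimes>\<^bsub>H\<^esub> y) \<otimes>\<^bsub>H\<^esub> (?S z \<otimes>\<^bsub>H\<^esub> ?S c)) h = counit H h \<odot>\<^bsub>H\<^esub> (b \<otimes>\<^bsub>H\<^esub> ?S c)"
      if "b \<in> carrier H" "c \<in> carrier H" for b c
    proof -
      have "?s (\<lambda>y z. (b \<otimes>\<^bsub>H\<^esub> y) \<otimes>\<^bsub>H\<^esub> (?S z \<otimes>\<^bsub>H\<^esub> ?S c)) h = ?s (\<lambda>y z. b \<otimes>\<^bsub>H\<^esub> ((y \<otimes>\<^bsub>H\<^esub> ?S z) \<otimes>\<^bsub>H\<^esub> ?S c)) h"
        using that h by (intro sweedler_cong) (simp_all add: m_assoc)
      also have "\<dots> = counit H h \<odot>\<^bsub>H\<^esub> (b \<otimes>\<^bsub>H\<^esub> (\<one>\<^bsub>H\<^esub> \<otimes>\<^bsub>H\<^esub> ?S c))"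
        using that h
        by (intro sweedler_antipode_right[of H "\<lambda>w. b \<otimes>\<^bsub>H\<^esub> (w \<otimes>\<^bsub>H\<^esub> ?S c)"] intros) simp_all
      finally show ?thesis using that by simp
    qed
    then have "?s (\<lambda>b c. ?s (\<lambda>y z. (b \<otimes>\<^bsub>H\<^esub> y) \<otimes>\<^bsub>H\<^esub> (?S z \<otimes>\<^bsub>H\<^esub> ?S c)) h) g
        = ?s (\<lambda>b c. counit H h \<odot>\<^bsub>H\<^esub> (b \<otimes>\<^bsub>H\<^esub> ?S c)) g"
      using g h by (intro sweedler_cong sweedler_closed) simp_all
    also have "\<dots> = counit H g \<odot>\<^bsub>H\<^esub> (counit H h \<odot>\<^bsub>H\<^esub> \<one>\<^bsub>H\<^esub>)"
      using g h by (intro sweedler_antipode_right[of H "\<lambda>w. counit H h \<odot>\<^bsub>H\<^esub> w"] intros) simp_all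
    finally show ?thesis .
  qed
  \<comment> \<open>S(g h) is a left inverse by the antipode axiom at the product, with \<Delta>(g
    h) expanded by \<open>sweedler_mult\<close>.\<close>
  have left: "?s (\<lambda>a b. ?s (\<lambda>x y. ?S (a \<otimes>\<^bsub>H\<^esub> x) \<otimes>\<^bsub>H\<^esub> (b \<otimes>\<^bsub>H\<^esub> y)) h) g
      = counit H g \<odot>\<^bsub>H\<^esub> (counit H h \<odot>\<^bsub>H\<^esub> \<one>\<^bsub>H\<^esub>)" if g: "g \<in> carrier H" and h: "h \<in> carrier H" for g h
  proof -
    have "(\<lambda>a b. ?S a \<otimes>\<^bsub>H\<^esub> b) \<in> bilinear_maps K H H H"
      by (intro bilinear_mapsI intros) simp_all
    from sweedler_mult[OF module_H this g h] show ?thesis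
      using g h by (simp add: antipode_left counit_mult smult_assoc1)
  qed
  \<comment> \<open>Counits are inserted for both arguments so that the right inverse identity can
    replace them by products.\<close>
  have "?S (g \<otimes>\<^bsub>H\<^esub> h) = ?s (\<lambda>a a'. counit H a' \<odot>\<^bsub>H\<^esub> ?s (\<lambda>x x'. counit H x' \<odot>\<^bsub>H\<^esub> ?S (a \<otimes>\<^bsub>H\<^esub> x)) h) g"
    using g h
    by (subst sweedler_counit_right[of H "\<lambda>a. ?s (\<lambda>x x'. counit H x' \<odot>\<^bsub>H\<^esub> ?S (a \<otimes>\<^bsub>H\<^esub> x)) h" g];
        (subst sweedler_counit_right[of H "\<lambda>x. ?S (g \<otimes>\<^bsub>H\<^esub> x)" h])?; (intro intros)?) simp_all
  also have "\<dots> = ?s (\<lambda>a a'. ?s (\<lambda>x x'. counit H a' \<odot>\<^bsub>H\<^esub> (counit H x' \<odot>\<^bsub>H\<^esub> ?S (a \<otimes>\<^bsub>H\<^esub> x))) h) g"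
    using g h
    by (intro sweedler_cong sweedler_comp[where f = "\<lambda>w. _ \<odot>\<^bsub>H\<^esub> w"] intros) simp_all
  also have "\<dots> = ?s (\<lambda>a a'. ?s (\<lambda>x x'. ?s (\<lambda>b c. ?s (\<lambda>y z. ?\<psi> a b c x y z) x') a') h) g"
  proof -
    have "?s (\<lambda>b c. ?s (\<lambda>y z. ?\<psi> a b c x y z) x') a' = counit H a' \<odot>\<^bsub>H\<^esub> (counit H x' \<odot>\<^bsub>H\<^esub> ?S (a \<otimes>\<^bsub>H\<^esub> x))"
      if "a \<in> carrier H" "a' \<in> carrier H" "x \<in> carrier H" "x' \<in> carrier H" for a a' x x'
    proof -
      let ?f = "\<lambda>w. ?S (a \<otimes>\<^bsub>H\<^esub> x) \<otimes>\<^bsub>H\<^esub> w"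
      have f: "?f \<in> linear_maps K H H" using that by (intro intros) simp_all
      have "?s (\<lambda>b c. ?s (\<lambda>y z. ?\<psi> a b c x y z) x') a' = ?s (\<lambda>b c. ?f (?s (\<lambda>y z. (b \<otimes>\<^bsub>H\<^esub> y) \<otimes>\<^bsub>H\<^esub> (?S z \<otimes>\<^bsub>H\<^esub> ?S c)) x')) a'"
        using that by (intro sweedler_cong sweedler_comp[OF _ _ f, symmetric] sweedler_closed) simp_all
      also have "\<dots> = ?f (?s (\<lambda>b c. ?s (\<lambda>y z. (b \<otimes>\<^bsub>H\<^esub> y) \<otimes>\<^bsub>H\<^esub> (?S z \<otimes>\<^bsub>H\<^esub> ?S c)) x') a')"
        using that by (intro sweedler_comp[OF _ _ f, symmetric] sweedler_closed) simp_all
      finally show ?thesis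
        using that by (simp add: right smult_mult_right)
    qed
    then show ?thesis using g h by (intro sweedler_cong sweedler_closed) simp_all
  qed
  \<comment> \<open>The two triple comultiplications have to be rebracketed separately; as their
    sums are nested, exchanges alternate with coassociativity until \<open>a\<close>,
    \<open>b\<close> and \<open>x\<close>, \<open>y\<close> are innermost.\<close>
  also have "\<dots> = ?s (\<lambda>a a'. ?s (\<lambda>b c. ?s (\<lambda>x x'. ?s (\<lambda>y z. ?\<psi> a b c x y z) x') h) a') g"
    using g h by (intro sweedler_cong sweedler_swap sweedler_closed) simp_all
  also have "\<dots> = ?s (\<lambda>a a'. ?s (\<lambda>b c. ?s (\<lambda>x' z. ?s (\<lambda>x y. ?\<psi> a b c x y z) x') h) a') g"
    using g h
    by (intro sweedler_cong[where h = g] sweedler_cong sweedler_coassoc[symmetric] intros) simp_all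
  also have "\<dots> = ?s (\<lambda>a' c. ?s (\<lambda>a b. ?s (\<lambda>x' z. ?s (\<lambda>x y. ?\<psi> a b c x y z) x') h) a') g"
    using g h by (intro sweedler_coassoc[symmetric] intros) simp_all
  also have "\<dots> = ?s (\<lambda>a' c. ?s (\<lambda>x' z. ?s (\<lambda>a b. ?s (\<lambda>x y. ?\<psi> a b c x y z) x') a') h) g"
    using g h by (intro sweedler_cong sweedler_swap sweedler_closed) simp_all
  also have "\<dots> = ?s (\<lambda>a' c. ?s (\<lambda>x' z. counit H a' \<odot>\<^bsub>H\<^esub> (counit H x' \<odot>\<^bsub>H\<^esub> (?S z \<otimes>\<^bsub>H\<^esub> ?S c))) h) g"
  proof -
    have "?s (\<lambda>a b. ?s (\<lambda>x y. ?\<psi> a b c x y z) x') a' = counit H a' \<odot>\<^bsub>H\<^esub> (counit H x' \<odot>\<^bsub>H\<^esub> (?S z \<otimes>\<^bsub>H\<^esub> ?S c))"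
      if "a' \<in> carrier H" "c \<in> carrier H" "x' \<in> carrier H" "z \<in> carrier H" for a' c x' z
    proof -
      let ?f = "\<lambda>w. w \<otimes>\<^bsub>H\<^esub> (?S z \<otimes>\<^bsub>H\<^esub> ?S c)"
      have f: "?f \<in> linear_maps K H H" using that by (intro intros) simp_all
      have "?s (\<lambda>a b. ?s (\<lambda>x y. ?\<psi> a b c x y z) x') a' = ?s (\<lambda>a b. ?s (\<lambda>x y. ?f (?S (a \<otimes>\<^bsub>H\<^esub> x) \<otimes>\<^bsub>H\<^esub> (b \<otimes>\<^bsub>H\<^esub> y))) x') a'"
        using that by (intro sweedler_cong sweedler_closed) (simp_all add: m_assoc)
      also have "\<dots> = ?s (\<lambda>a b. ?f (?s (\<lambda>x y. ?S (a \<otimes>\<^bsub>H\<^esub> x) \<otimes>\<^bsub>H\<^esub> (b \<otimes>\<^bsub>H\<^esub> y)) x')) a'"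
        using that by (intro sweedler_cong sweedler_comp[OF _ _ f, symmetric] sweedler_closed) simp_all
      also have "\<dots> = ?f (?s (\<lambda>a b. ?s (\<lambda>x y. ?S (a \<otimes>\<^bsub>H\<^esub> x) \<otimes>\<^bsub>H\<^esub> (b \<otimes>\<^bsub>H\<^esub> y)) x') a')"
        using that by (intro sweedler_comp[OF _ _ f, symmetric] sweedler_closed) simp_all
      finally show ?thesis
        using that by (simp add: left smult_mult_left)
    qed
    then show ?thesis using g h by (intro sweedler_cong sweedler_closed) simp_all
  qed
  also have "\<dots> = ?s (\<lambda>a' c. counit H a' \<odot>\<^bsub>H\<^esub> ?s (\<lambda>x' z. counit H x' \<odot>\<^bsub>H\<^esub> (?S z \<otimes>\<^bsub>H\<^esub> ?S c)) h) g"
    using g h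
    by (intro sweedler_cong sweedler_comp[where f = "\<lambda>w. _ \<odot>\<^bsub>H\<^esub> w", symmetric] intros) simp_all
  also have "\<dots> = ?S h \<otimes>\<^bsub>H\<^esub> ?S g"
    using g h
    by (subst sweedler_counit_left[of H "\<lambda>c. ?s (\<lambda>x' z. counit H x' \<odot>\<^bsub>H\<^esub> (?S z \<otimes>\<^bsub>H\<^esub> ?S c)) h" g];
        (subst sweedler_counit_left[of H "\<lambda>z. ?S z \<otimes>\<^bsub>H\<^esub> ?S g" h])?; (intro intros)?) simp_all
  finally show ?thesis .
qed

end

section \<open>Modules over the smash product\<close>

lemma linear_maps_pure_tensor [linear_intros]:
  assumes "field K" and "module K M" and "module K N"
  shows "\<lbrakk>f \<in> linear_maps K V M; y \<in> carrier N\<rbrakk>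
      \<Longrightarrow> (\<lambda>v. pure_tensor K M N (f v) y) \<in> linear_maps K V (tensor K M N)"
    and "\<lbrakk>g \<in> linear_maps K V N; x \<in> carrier M\<rbrakk>
      \<Longrightarrow> (\<lambda>v. pure_tensor K M N x (g v)) \<in> linear_maps K V (tensor K M N)"
  using field.pure_tensor_bilinear[OF assms]
  by (auto intro: linear_maps_comp bilinear_maps_left bilinear_maps_right
      linear_maps_comp[where g = "\<lambda>z. pure_tensor K M N z y"])

context left_H_category
begin

section \<open>Composition in the smash product\<close>

lemma field_K [simp, intro]: "field K"
  by (rule field_axioms)

lemma
  assumes "X \<in> Ob C" and "Y \<in> Ob C"
  shows Act_bilinear: "Act C X Y \<in> bilinear_maps K H (Hom C X Y) (Hom C X Y)"
    and Act_mult: "\<lbrakk>g \<in> carrier H; h \<in> carrier H; f \<in> carrier (Hom C X Y)\<rbrakk>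
      \<Longrightarrow> Act C X Y (g \<otimes>\<^bsub>H\<^esub> h) f = Act C X Y g (Act C X Y h f)"
    and Act_one: "f \<in> carrier (Hom C X Y) \<Longrightarrow> Act C X Y \<one>\<^bsub>H\<^esub> f = f"
proof -
  interpret A: left_module K H "Hom C X Y" "Act C X Y" by (rule Act_module[OF assms])
  show "Act C X Y \<in> bilinear_maps K H (Hom C X Y) (Hom C X Y)" by (rule A.act_bilinear)
  show "Act C X Y (g \<otimes>\<^bsub>H\<^esub> h) f = Act C X Y g (Act C X Y h f)"
    if "g \<in> carrier H" "h \<in> carrier H" "f \<in> carrier (Hom C X Y)"
    using that by (rule A.act_mult)
  show "Act C X Y \<one>\<^bsub>H\<^esub> f = f" if "f \<in> carrier (Hom C X Y)"
    using that by (rule A.act_one)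
qed

lemma Act_closed [simp, intro]:
  "\<lbrakk>X \<in> Ob C; Y \<in> Ob C; h \<in> carrier H; f \<in> carrier (Hom C X Y)\<rbrakk>
    \<Longrightarrow> Act C X Y h f \<in> carrier (Hom C X Y)"
  by (rule bilinear_maps_closed[OF Act_bilinear])

lemma Cmp_closed [simp, intro]:
  "\<lbrakk>X \<in> Ob C; Y \<in> Ob C; Z \<in> Ob C; f \<in> carrier (Hom C Y Z); g \<in> carrier (Hom C X Y)\<rbrakk>
    \<Longrightarrow> Cmp C X Y Z f g \<in> carrier (Hom C X Z)"
  by (rule bilinear_maps_closed[OF Cmp_bilinear])

lemma linear_maps_Act [linear_intros]:
  assumes "X \<in> Ob C" and "Y \<in> Ob C"
  shows "\<lbrakk>k \<in> linear_maps K V H; f \<in> carrier (Hom C X Y)\<rbrakk>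
      \<Longrightarrow> (\<lambda>v. Act C X Y (k v) f) \<in> linear_maps K V (Hom C X Y)"
    and "\<lbrakk>h \<in> carrier H; g \<in> linear_maps K V (Hom C X Y)\<rbrakk>
      \<Longrightarrow> (\<lambda>v. Act C X Y h (g v)) \<in> linear_maps K V (Hom C X Y)"
  using bilinear_mapsD(1,2)[OF Act_bilinear[OF assms]] by (auto intro: linear_maps_comp)

lemma linear_maps_Cmp [linear_intros]:
  assumes "X \<in> Ob C" and "Y \<in> Ob C" and "Z \<in> Ob C"
  shows "\<lbrakk>k \<in> linear_maps K V (Hom C Y Z); g \<in> carrier (Hom C X Y)\<rbrakk>
      \<Longrightarrow> (\<lambda>v. Cmp C X Y Z (k v) g) \<in> linear_maps K V (Hom C X Z)"
    and "\<lbrakk>f \<in> carrier (Hom C Y Z); k \<in> linear_maps K V (Hom C X Y)\<rbrakk>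
      \<Longrightarrow> (\<lambda>v. Cmp C X Y Z f (k v)) \<in> linear_maps K V (Hom C X Z)"
  using bilinear_mapsD(1,2)[OF Cmp_bilinear[OF assms]] by (auto intro: linear_maps_comp)

lemma smash_simps [simp]:
  "Ob (smash K H C) = Ob C" "Hom (smash K H C) X Y = tensor K (Hom C X Y) H"
  "Idt (smash K H C) X = pure_tensor K (Hom C X X) H (Idt C X) \<one>\<^bsub>H\<^esub>"
  by (simp_all add: smash_def)

lemma smash_Hom_module: "\<lbrakk>X \<in> Ob C; Y \<in> Ob C\<rbrakk> \<Longrightarrow> module K (tensor K (Hom C X Y) H)"
  by (rule tensor_is_module[OF Hom_module module_H])

lemma smash_pure_closed [simp, intro]:
  "\<lbrakk>X \<in> Ob C; Y \<in> Ob C; f \<in> carrier (Hom C X Y); h \<in> carrier H\<rbrakk>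
    \<Longrightarrow> pure_tensor K (Hom C X Y) H f h \<in> carrier (tensor K (Hom C X Y) H)"
  by (rule bilinear_maps_closed[OF pure_tensor_bilinear[OF Hom_module module_H]])

text \<open>\<open>Cmp\<close> is a lift within a lift, so evaluation on pure tensors needs
  bilinearity twice: in the second pair with the first fixed, and in the first pair with an
  arbitrary second tensor.\<close>

lemma smash_Cmp_pure:
  assumes X: "X \<in> Ob C" and Y: "Y \<in> Ob C" and Z: "Z \<in> Ob C"
    and f: "f \<in> carrier (Hom C Y Z)" and h: "h \<in> carrier H"
    and g: "g \<in> carrier (Hom C X Y)" and h': "h' \<in> carrier H"
  shows "Cmp (smash K H C) X Y Z (pure_tensor K (Hom C Y Z) H f h) (pure_tensor K (Hom C X Y) H g h')
    = sweedler K H (tensor K (Hom C X Z) H)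
        (\<lambda>h\<^sub>1 h\<^sub>2. pure_tensor K (Hom C X Z) H (Cmp C X Y Z f (Act C X Y h\<^sub>1 g)) (h\<^sub>2 \<otimes>\<^bsub>H\<^esub> h')) h"
proof -
  let ?T = "tensor K (Hom C X Z) H"
  let ?\<zeta> = "\<lambda>f h g h'. sweedler K H ?T
    (\<lambda>h\<^sub>1 h\<^sub>2. pure_tensor K (Hom C X Z) H (Cmp C X Y Z f (Act C X Y h\<^sub>1 g)) (h\<^sub>2 \<otimes>\<^bsub>H\<^esub> h')) h"
  note mods = Hom_module[OF X Y] Hom_module[OF Y Z] Hom_module[OF X Z] smash_Hom_module[OF X Z] module_H
  note intros = linear_intros linear_maps_id mods
  have inner: "?\<zeta> f h \<in> bilinear_maps K (Hom C X Y) H ?T"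
    if "f \<in> carrier (Hom C Y Z)" "h \<in> carrier H" for f h
    using that X Y Z by (intro bilinear_mapsI intros) simp_all
  \<comment> \<open>The inner lift is a sum over the fixed representative of \<open>t\<close>, so
    linearity in \<open>f\<close> and in \<open>h\<close> passes through it.\<close>
  have outer: "(\<lambda>f h. tensor_lift K ?T (?\<zeta> f h) t) \<in> bilinear_maps K (Hom C Y Z) H ?T"
    if t: "t \<in> carrier (tensor K (Hom C X Y) H)" for t
    using t X Y Z by (intro bilinear_mapsI tensor_lift_linear_arg[OF _ _ _ _ t] intros) simp_all
  show ?thesis
    using X Y f h g h'
    by (simp add: smash_def Let_def tensor_lift_pure[OF mods(2,5,4) outer]
        tensor_lift_pure[OF mods(1,5,4) inner])
qed

text \<open>As \<Delta>(1) has a single summand, no twisting occurs. This makes f \<mapsto> f # 1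
  multiplicative and yields the factorization of f # h into f # 1 and id # h.\<close>

lemma smash_Cmp_pure_one:
  assumes "X \<in> Ob C" and "Y \<in> Ob C" and "Z \<in> Ob C" and "f \<in> carrier (Hom C Y Z)"
    and "g \<in> carrier (Hom C X Y)" and "h \<in> carrier H"
  shows "Cmp (smash K H C) X Y Z (pure_tensor K (Hom C Y Z) H f \<one>\<^bsub>H\<^esub>) (pure_tensor K (Hom C X Y) H g h)
    = pure_tensor K (Hom C X Z) H (Cmp C X Y Z f g) h"
proof -
  have "(\<lambda>a b. pure_tensor K (Hom C X Z) H (Cmp C X Y Z f (Act C X Y a g)) (b \<otimes>\<^bsub>H\<^esub> h))
      \<in> bilinear_maps K H H (tensor K (Hom C X Z) H)"
    using assms by (intro bilinear_mapsI linear_intros linear_maps_id Hom_module) simp_all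
  from sweedler_one[OF smash_Hom_module this] show ?thesis
    using assms by (simp add: smash_Cmp_pure Act_one)
qed

end

locale smash_module = left_H_category K H C + right_cat_module K "smash K H C" M
  for K :: "('k, 'x) ring_scheme" and H :: "('k, 'h, 'y) hopf_scheme"
    and C :: "('k, 'o, 'f, 'h, 'z) hcat_scheme"
    and M :: "('k, 'o, ('f \<times> 'h \<Rightarrow> 'k) set, 'm) cat_module"
begin

text \<open>The action written m k in the overview; \<open>val_act\<close> is obtained from it by
  inserting the antipode.\<close>

definition ract :: "'o \<Rightarrow> 'h \<Rightarrow> 'm \<Rightarrow> 'm" where
  "ract X h m = Mor M X X (pure_tensor K (Hom C X X) H (Idt C X) h) m"

definition cact :: "'o \<Rightarrow> 'o \<Rightarrow> 'f \<Rightarrow> 'm \<Rightarrow> 'm" where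
  "cact X Y f m = Mor M X Y (pure_tensor K (Hom C X Y) H f \<one>\<^bsub>H\<^esub>) m"

lemma val_act_eq_ract: "val_act K H C M X h m = ract X (antipode H h) m"
  by (simp add: val_act_def ract_def)

lemma Val_module' [simp, intro]: "X \<in> Ob C \<Longrightarrow> module K (Val M X)"
  using Val_module by simp

lemma Mor_bilinear':
  "\<lbrakk>X \<in> Ob C; Y \<in> Ob C\<rbrakk>
    \<Longrightarrow> Mor M X Y \<in> bilinear_maps K (tensor K (Hom C X Y) H) (Val M Y) (Val M X)"
  using Mor_bilinear by simp

lemma Mor_Cmp_pure:
  assumes "X \<in> Ob C" and "Y \<in> Ob C" and "Z \<in> Ob C" and "f \<in> carrier (Hom C Y Z)" and "h \<in> carrier H"
    and "g \<in> carrier (Hom C X Y)" and "h' \<in> carrier H" and m: "m \<in> carrier (Val M Z)"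
  shows "Mor M X Y (pure_tensor K (Hom C X Y) H g h') (Mor M Y Z (pure_tensor K (Hom C Y Z) H f h) m)
    = sweedler K H (Val M X) (\<lambda>h\<^sub>1 h\<^sub>2.
        Mor M X Z (pure_tensor K (Hom C X Z) H (Cmp C X Y Z f (Act C X Y h\<^sub>1 g)) (h\<^sub>2 \<otimes>\<^bsub>H\<^esub> h')) m) h"
  using assms
  by (simp add: Mor_Cmp[symmetric] smash_Cmp_pure
      sweedler_comp[OF smash_Hom_module Val_module' bilinear_maps_left[OF Mor_bilinear' m]])

text \<open>By contravariance the factorization f # h = (f # 1)(id # h) lets f act before h. A
  module over the smash product is thereby governed by \<open>cact\<close> and
  \<open>ract\<close>.\<close>

lemma Mor_pure_eq:
  assumes "X \<in> Ob C" and "Y \<in> Ob C" and "f \<in> carrier (Hom C X Y)" and "h \<in> carrier H"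
    and "m \<in> carrier (Val M Y)"
  shows "Mor M X Y (pure_tensor K (Hom C X Y) H f h) m = ract X h (cact X Y f m)"
  using assms
  by (simp add: ract_def cact_def Idt_closed Mor_Cmp[symmetric] smash_Cmp_pure_one Cmp_Idt_right)

lemma ract_closed [simp, intro]:
  "\<lbrakk>X \<in> Ob C; h \<in> carrier H; m \<in> carrier (Val M X)\<rbrakk> \<Longrightarrow> ract X h m \<in> carrier (Val M X)"
  unfolding ract_def
  by (rule bilinear_maps_closed[OF Mor_bilinear' smash_pure_closed]) (auto intro: Idt_closed)

lemma cact_closed [simp, intro]:
  "\<lbrakk>X \<in> Ob C; Y \<in> Ob C; f \<in> carrier (Hom C X Y); m \<in> carrier (Val M Y)\<rbrakk>
    \<Longrightarrow> cact X Y f m \<in> carrier (Val M X)"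
  unfolding cact_def
  by (rule bilinear_maps_closed[OF Mor_bilinear' smash_pure_closed]) auto

lemma linear_maps_Mor:
  assumes "X \<in> Ob C" and "Y \<in> Ob C"
  shows "\<lbrakk>s \<in> linear_maps K V (tensor K (Hom C X Y) H); m \<in> carrier (Val M Y)\<rbrakk>
      \<Longrightarrow> (\<lambda>v. Mor M X Y (s v) m) \<in> linear_maps K V (Val M X)"
    and "\<lbrakk>t \<in> carrier (tensor K (Hom C X Y) H); n \<in> linear_maps K V (Val M Y)\<rbrakk>
      \<Longrightarrow> (\<lambda>v. Mor M X Y t (n v)) \<in> linear_maps K V (Val M X)"
  using bilinear_mapsD(1,2)[OF Mor_bilinear'[OF assms]] by (auto intro: linear_maps_comp)

lemma linear_maps_ract [linear_intros]:
  assumes "X \<in> Ob C"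
  shows "\<lbrakk>k \<in> linear_maps K V H; m \<in> carrier (Val M X)\<rbrakk>
      \<Longrightarrow> (\<lambda>v. ract X (k v) m) \<in> linear_maps K V (Val M X)"
    and "\<lbrakk>h \<in> carrier H; n \<in> linear_maps K V (Val M X)\<rbrakk>
      \<Longrightarrow> (\<lambda>v. ract X h (n v)) \<in> linear_maps K V (Val M X)"
  unfolding ract_def using assms
  by (intro linear_maps_Mor linear_intros; simp add: Idt_closed Hom_module)+

lemma linear_maps_cact [linear_intros]:
  assumes "X \<in> Ob C" and "Y \<in> Ob C"
  shows "\<lbrakk>k \<in> linear_maps K V (Hom C X Y); m \<in> carrier (Val M Y)\<rbrakk>
      \<Longrightarrow> (\<lambda>v. cact X Y (k v) m) \<in> linear_maps K V (Val M X)"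
    and "\<lbrakk>f \<in> carrier (Hom C X Y); n \<in> linear_maps K V (Val M Y)\<rbrakk>
      \<Longrightarrow> (\<lambda>v. cact X Y f (n v)) \<in> linear_maps K V (Val M X)"
  unfolding cact_def using assms
  by (intro linear_maps_Mor linear_intros; simp add: Hom_module)+

lemma ract_one: "\<lbrakk>X \<in> Ob C; m \<in> carrier (Val M X)\<rbrakk> \<Longrightarrow> ract X \<one>\<^bsub>H\<^esub> m = m"
  using Mor_Idt by (simp add: ract_def)

text \<open>The image of (id # h)(f # 1) = \<Sum> (h_1 f) # h_2, with each summand split by
  \<open>Mor_pure_eq\<close>.\<close>

lemma cact_ract:
  assumes "X \<in> Ob C" and "Y \<in> Ob C" and "f \<in> carrier (Hom C X Y)" and "h \<in> carrier H"
    and "m \<in> carrier (Val M Y)"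
  shows "cact X Y f (ract Y h m)
    = sweedler K H (Val M X) (\<lambda>h\<^sub>1 h\<^sub>2. ract X h\<^sub>2 (cact X Y (Act C X Y h\<^sub>1 f) m)) h"
proof -
  have "cact X Y f (ract Y h m) = sweedler K H (Val M X) (\<lambda>h\<^sub>1 h\<^sub>2.
      Mor M X Y (pure_tensor K (Hom C X Y) H (Cmp C X Y Y (Idt C Y) (Act C X Y h\<^sub>1 f)) (h\<^sub>2 \<otimes>\<^bsub>H\<^esub> \<one>\<^bsub>H\<^esub>)) m) h"
    unfolding cact_def ract_def using assms by (intro Mor_Cmp_pure) (simp_all add: Idt_closed)
  also have "\<dots> = sweedler K H (Val M X) (\<lambda>h\<^sub>1 h\<^sub>2. ract X h\<^sub>2 (cact X Y (Act C X Y h\<^sub>1 f) m)) h"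
    using assms by (intro sweedler_cong) (simp_all add: Idt_closed Cmp_Idt_left Mor_pure_eq)
  finally show ?thesis .
qed

text \<open>In (id # g)(id # h) the element g_1 acts on an identity, hence through the counit, which
  leaves id # g h. Contravariance makes the action a right one.\<close>

lemma ract_mult:
  assumes "X \<in> Ob C" and "g \<in> carrier H" and "h \<in> carrier H" and "m \<in> carrier (Val M X)"
  shows "ract X (g \<otimes>\<^bsub>H\<^esub> h) m = ract X h (ract X g m)"
proof -
  interpret X: module K "Hom C X X" using assms(1) by (simp add: Hom_module)
  interpret V: module K "Val M X" using assms(1) by (rule Val_module')
  have "ract X h (ract X g m) = sweedler K H (Val M X) (\<lambda>g\<^sub>1 g\<^sub>2.
      Mor M X X (pure_tensor K (Hom C X X) H (Cmp C X X X (Idt C X) (Act C X X g\<^sub>1 (Idt C X))) (g\<^sub>2 \<otimes>\<^bsub>H\<^esub> h)) m) g"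
    unfolding ract_def using assms by (intro Mor_Cmp_pure) (simp_all add: Idt_closed)
  also have "\<dots> = sweedler K H (Val M X) (\<lambda>g\<^sub>1 g\<^sub>2. counit H g\<^sub>1 \<odot>\<^bsub>Val M X\<^esub> ract X (g\<^sub>2 \<otimes>\<^bsub>H\<^esub> h) m) g"
  proof (intro sweedler_cong)
    fix a b assume ab: "a \<in> carrier H" "b \<in> carrier H"
    have "(\<lambda>v. Mor M X X (pure_tensor K (Hom C X X) H v (b \<otimes>\<^bsub>H\<^esub> h)) m) \<in> linear_maps K (Hom C X X) (Val M X)"
      using assms ab by (intro linear_maps_Mor linear_intros linear_maps_id) (simp_all add: Hom_module)
    from linear_maps_smult[OF this]
    show "Mor M X X (pure_tensor K (Hom C X X) H (Cmp C X X X (Idt C X) (Act C X X a (Idt C X))) (b \<otimes>\<^bsub>H\<^esub> h)) m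
        = counit H a \<odot>\<^bsub>Val M X\<^esub> ract X (b \<otimes>\<^bsub>H\<^esub> h) m"
      using assms ab by (simp add: Idt_closed Cmp_Idt_left Act_Idt ract_def)
  qed (use assms in \<open>simp_all add: Idt_closed Mor_pure_eq\<close>)
  also have "\<dots> = ract X (g \<otimes>\<^bsub>H\<^esub> h) m"
    using assms by (intro sweedler_counit_left linear_intros linear_maps_id) simp_all
  finally show ?thesis by simp
qed

text \<open>A convolution inverse argument in the module: from \<Sum> B(h_1) h_2 = \<epsilon>(h) v,
  acting with one more S(h_3) gives B(h) on one side and v S(h) on the other.\<close>

lemma eq_ract_antipode:
  assumes X: "X \<in> Ob C" and v: "v \<in> carrier (Val M X)" and B: "B \<in> linear_maps K H (Val M X)"
    and eq: "\<And>h. h \<in> carrier H \<Longrightarrow>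
      sweedler K H (Val M X) (\<lambda>a b. ract X b (B a)) h = counit H h \<odot>\<^bsub>Val M X\<^esub> v"
    and h: "h \<in> carrier H"
  shows "B h = ract X (antipode H h) v"
proof -
  interpret V: module K "Val M X" using X by (rule Val_module')
  let ?s = "sweedler K H (Val M X)" and ?S = "antipode H"
  note B_closed [simp] = linear_maps_closed[OF B]
  note intros = linear_intros linear_maps_id B module_H Val_module' linear_maps_comp[OF _ B]
  have lin: "(\<lambda>w. ract X (?S b) w) \<in> linear_maps K (Val M X) (Val M X)" if "b \<in> carrier H" for b
    using X that by (intro intros) simp_all
  have "ract X (?S h) v = ?s (\<lambda>a b. counit H a \<odot>\<^bsub>Val M X\<^esub> ract X (?S b) v) h"
    using X v h by (intro sweedler_counit_left[symmetric] intros) simp_all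
  also have "\<dots> = ?s (\<lambda>a b. ract X (?S b) (?s (\<lambda>c d. ract X d (B c)) a)) h"
    using X v h by (intro sweedler_cong) (simp_all add: eq linear_maps_smult[OF lin])
  also have "\<dots> = ?s (\<lambda>a b. ?s (\<lambda>c d. ract X (?S b) (ract X d (B c))) a) h"
    using X v h by (intro sweedler_cong sweedler_comp lin) simp_all
  also have "\<dots> = ?s (\<lambda>c a. ?s (\<lambda>d b. ract X (?S b) (ract X d (B c))) a) h"
    using X v h by (intro sweedler_coassoc intros) simp_all
  also have "\<dots> = ?s (\<lambda>c a. ?s (\<lambda>d b. ract X (d \<otimes>\<^bsub>H\<^esub> ?S b) (B c)) a) h"
    using X v h by (intro sweedler_cong) (simp_all add: ract_mult)
  also have "\<dots> = ract X \<one>\<^bsub>H\<^esub> (B h)"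
    using X v h
    by (intro sweedler_cancel_right_antipode'[where \<psi> = "\<lambda>c w. ract X w (B c)"] intros) simp_all
  finally show ?thesis using X h by (simp add: ract_one)
qed

text \<open>The variant with reversed order: from \<Sum> B(h_2) S(h_1) = \<epsilon>(h) v, acting
  with S^2 produces \<Sum> B(h_3) S(h_2) S^2(h_1).\<close>

lemma eq_ract_antipode_antipode:
  assumes X: "X \<in> Ob C" and v: "v \<in> carrier (Val M X)" and B: "B \<in> linear_maps K H (Val M X)"
    and eq: "\<And>h. h \<in> carrier H \<Longrightarrow>
      sweedler K H (Val M X) (\<lambda>a b. ract X (antipode H a) (B b)) h = counit H h \<odot>\<^bsub>Val M X\<^esub> v"
    and h: "h \<in> carrier H"
  shows "B h = ract X (antipode H (antipode H h)) v"
proof -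
  interpret V: module K "Val M X" using X by (rule Val_module')
  let ?s = "sweedler K H (Val M X)" and ?S = "antipode H"
  note B_closed [simp] = linear_maps_closed[OF B]
  note intros = linear_intros linear_maps_id B module_H Val_module' linear_maps_comp[OF _ B]
  have lin: "(\<lambda>w. ract X (?S (?S b)) w) \<in> linear_maps K (Val M X) (Val M X)" if "b \<in> carrier H" for b
    using X that by (intro intros) simp_all
  have "ract X (?S (?S h)) v = ?s (\<lambda>a b. counit H b \<odot>\<^bsub>Val M X\<^esub> ract X (?S (?S a)) v) h"
    using X v h by (intro sweedler_counit_right[symmetric] intros) simp_all
  also have "\<dots> = ?s (\<lambda>a b. ract X (?S (?S a)) (?s (\<lambda>c d. ract X (?S c) (B d)) b)) h"
    using X v h by (intro sweedler_cong) (simp_all add: eq linear_maps_smult[OF lin])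
  also have "\<dots> = ?s (\<lambda>a b. ?s (\<lambda>c d. ract X (?S (?S a)) (ract X (?S c) (B d))) b) h"
    using X v h by (intro sweedler_cong sweedler_comp lin) simp_all
  also have "\<dots> = ?s (\<lambda>b d. ?s (\<lambda>a c. ract X (?S (?S a)) (ract X (?S c) (B d))) b) h"
    using X v h by (intro sweedler_coassoc[symmetric] intros) simp_all
  \<comment> \<open>Reversal of products under S rewrites S(h_2) S^2(h_1) as S(S(h_1) h_2), an
    argument that collapses.\<close>
  also have "\<dots> = ?s (\<lambda>b d. ?s (\<lambda>a c. ract X (?S (?S a \<otimes>\<^bsub>H\<^esub> c)) (B d)) b) h"
    using X v h by (intro sweedler_cong) (simp_all add: antipode_mult ract_mult)
  also have "\<dots> = ract X (?S \<one>\<^bsub>H\<^esub>) (B h)"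
    using X v h
    by (intro sweedler_cancel_left_antipode[where \<psi> = "\<lambda>w d. ract X (?S w) (B d)"] intros) simp_all
  finally show ?thesis using X h by (simp add: ract_one antipode_one)
qed

text \<open>The right-hand side, as a function of \<open>h\<close>, is identified through
  \<open>eq_ract_antipode\<close>; only its convolution with the action has to be computed.\<close>

lemma ract_antipode_cact:
  assumes X: "X \<in> Ob C" and Y: "Y \<in> Ob C" and f: "f \<in> carrier (Hom C X Y)"
    and m: "m \<in> carrier (Val M Y)" and h: "h \<in> carrier H"
  shows "ract X (antipode H h) (cact X Y f m)
    = sweedler K H (Val M X) (\<lambda>a b. cact X Y (Act C X Y b f) (ract Y (antipode H a) m)) h"
proof -
  interpret V: module K "Val M X" using X by (rule Val_module')
  let ?s = "sweedler K H (Val M X)" and ?S = "antipode H"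
  let ?B = "?s (\<lambda>a b. cact X Y (Act C X Y b f) (ract Y (?S a) m))"
  note intros = linear_intros linear_maps_id module_H Val_module'
  have "?B h = ract X (?S h) (cact X Y f m)"
  proof (rule eq_ract_antipode[OF X _ _ _ h])
    show "?B \<in> linear_maps K H (Val M X)"
      using X Y f m by (intro intros) simp_all
    fix h assume h: "h \<in> carrier H"
    have "?s (\<lambda>a b. ract X b (?B a)) h
        = ?s (\<lambda>a b. ?s (\<lambda>c d. ract X b (cact X Y (Act C X Y d f) (ract Y (?S c) m))) a) h"
      using X Y f m h by (intro sweedler_cong sweedler_comp[where f = "ract X _"] intros) simp_all
    also have "\<dots> = ?s (\<lambda>c a. ?s (\<lambda>d b. ract X b (cact X Y (Act C X Y d f) (ract Y (?S c) m))) a) h"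
      using X Y f m h by (intro sweedler_coassoc intros) simp_all
    \<comment> \<open>The inner sum is \<open>cact_ract\<close> read backwards: (n (h_2 f)) h_3 adds
      up to (n h_2) f with n = m S(h_1).\<close>
    also have "\<dots> = ?s (\<lambda>c a. cact X Y f (ract Y (?S c \<otimes>\<^bsub>H\<^esub> a) m)) h"
      using X Y f m h by (intro sweedler_cong) (simp_all add: cact_ract ract_mult)
    also have "\<dots> = counit H h \<odot>\<^bsub>Val M X\<^esub> cact X Y f (ract Y \<one>\<^bsub>H\<^esub> m)"
      using X Y f m h
      by (intro sweedler_antipode_left[where f = "\<lambda>w. cact X Y f (ract Y w m)"] intros) simp_all
    finally show "?s (\<lambda>a b. ract X b (?B a)) h = counit H h \<odot>\<^bsub>Val M X\<^esub> cact X Y f m"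
      using Y m by (simp add: ract_one)
  qed (use X Y f m in simp)
  then show ?thesis by simp
qed

text \<open>Identified through \<open>eq_ract_antipode_antipode\<close>. The required convolution is
  evaluated by moving S(h_1) past the morphism with the preceding rule.\<close>

lemma ract_antipode_antipode_cact:
  assumes X: "X \<in> Ob C" and Y: "Y \<in> Ob C" and f: "f \<in> carrier (Hom C X Y)"
    and m: "m \<in> carrier (Val M Y)" and h: "h \<in> carrier H"
  shows "ract X (antipode H (antipode H h)) (cact X Y f m)
    = sweedler K H (Val M X)
        (\<lambda>a b. cact X Y (Act C X Y (antipode H a) f) (ract Y (antipode H (antipode H b)) m)) h"
proof -
  interpret V: module K "Val M X" using X by (rule Val_module')
  let ?s = "sweedler K H (Val M X)" and ?S = "antipode H"
  let ?B = "?s (\<lambda>a b. cact X Y (Act C X Y (?S a) f) (ract Y (?S (?S b)) m))"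
  note intros = linear_intros linear_maps_id module_H Val_module'
  have "?B h = ract X (?S (?S h)) (cact X Y f m)"
  proof (rule eq_ract_antipode_antipode[OF X _ _ _ h])
    show "?B \<in> linear_maps K H (Val M X)"
      using X Y f m by (intro intros) simp_all
    fix h assume h: "h \<in> carrier H"
    have "?s (\<lambda>h\<^sub>1 h\<^sub>2. ract X (?S h\<^sub>1) (?B h\<^sub>2)) h
        = ?s (\<lambda>h\<^sub>1 h\<^sub>2. ?s (\<lambda>c d. ract X (?S h\<^sub>1) (cact X Y (Act C X Y (?S c) f) (ract Y (?S (?S d)) m))) h\<^sub>2) h"
      using X Y f m h by (intro sweedler_cong sweedler_comp[where f = "ract X _"] intros) simp_all
    \<comment> \<open>In fourfold notation the summand is (m S(h_1 S(h_4))) (h_2 S(h_3) f). The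
      middle pair cancels first, which makes the outer pair adjacent.\<close>
    also have "\<dots> = ?s (\<lambda>h\<^sub>1 h\<^sub>2. ?s (\<lambda>c d. ?s (\<lambda>a b.
        cact X Y (Act C X Y (b \<otimes>\<^bsub>H\<^esub> ?S c) f) (ract Y (?S (a \<otimes>\<^bsub>H\<^esub> ?S d)) m)) h\<^sub>1) h\<^sub>2) h"
      using X Y f m h
      by (intro sweedler_cong) (simp_all add: ract_antipode_cact Act_mult antipode_mult ract_mult cong: sweedler_cong)
    also have "\<dots> = ?s (\<lambda>a d. cact X Y (Act C X Y \<one>\<^bsub>H\<^esub> f) (ract Y (?S (a \<otimes>\<^bsub>H\<^esub> ?S d)) m)) h"
      using X Y f m h
      by (intro sweedler_cancel_middle[where
            \<psi> = "\<lambda>a w d. cact X Y (Act C X Y w f) (ract Y (?S (a \<otimes>\<^bsub>H\<^esub> ?S d)) m)"] intros) simp_all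
    also have "\<dots> = counit H h \<odot>\<^bsub>Val M X\<^esub> cact X Y (Act C X Y \<one>\<^bsub>H\<^esub> f) (ract Y (?S \<one>\<^bsub>H\<^esub>) m)"
      using X Y f m h
      by (intro sweedler_antipode_right[where
            f = "\<lambda>w. cact X Y (Act C X Y \<one>\<^bsub>H\<^esub> f) (ract Y (?S w) m)"] intros) simp_all
    finally show "?s (\<lambda>a b. ract X (?S a) (?B b)) h = counit H h \<odot>\<^bsub>Val M X\<^esub> cact X Y f m"
      using X Y f m by (simp add: ract_one Act_one antipode_one)
  qed (use X Y f m in simp)
  then show ?thesis by simp
qed

end

section \<open>The action on natural transformations\<close>

lemma hom_mod_simps:
  "\<zero>\<^bsub>hom_mod K E M N\<^esub> = (\<lambda>X\<in>Ob E. \<lambda>m\<in>carrier (Val M X). \<zero>\<^bsub>Val N X\<^esub>)"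
  "\<eta> \<oplus>\<^bsub>hom_mod K E M N\<^esub> \<theta> = (\<lambda>X\<in>Ob E. \<lambda>m\<in>carrier (Val M X). \<eta> X m \<oplus>\<^bsub>Val N X\<^esub> \<theta> X m)"
  "a \<odot>\<^bsub>hom_mod K E M N\<^esub> \<eta> = (\<lambda>X\<in>Ob E. \<lambda>m\<in>carrier (Val M X). a \<odot>\<^bsub>Val N X\<^esub> \<eta> X m)"
  by (simp_all add: hom_mod_def)

lemma hom_mod_carrierD:
  assumes "\<eta> \<in> carrier (hom_mod K E M N)"
  shows hom_mod_linear: "X \<in> Ob E \<Longrightarrow> \<eta> X \<in> linear_maps K (Val M X) (Val N X)"
    and hom_mod_natural: "\<lbrakk>X \<in> Ob E; Y \<in> Ob E; f \<in> carrier (Hom E X Y); m \<in> carrier (Val M Y)\<rbrakk>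
      \<Longrightarrow> \<eta> X (Mor M X Y f m) = Mor N X Y f (\<eta> Y m)"
    and hom_mod_closed: "\<lbrakk>X \<in> Ob E; m \<in> carrier (Val M X)\<rbrakk> \<Longrightarrow> \<eta> X m \<in> carrier (Val N X)"
    and hom_mod_undefined: "X \<notin> Ob E \<Longrightarrow> \<eta> X = undefined"
      "\<lbrakk>X \<in> Ob E; m \<notin> carrier (Val M X)\<rbrakk> \<Longrightarrow> \<eta> X m = undefined"
  using assms by (auto simp: hom_mod_def linear_maps_def PiE_iff extensional_def)

lemma hom_mod_eqI:
  assumes "\<eta> \<in> carrier (hom_mod K E M N)" and "\<theta> \<in> carrier (hom_mod K E M N)"
    and "\<And>X m. X \<in> Ob E \<Longrightarrow> m \<in> carrier (Val M X) \<Longrightarrow> \<eta> X m = \<theta> X m"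
  shows "\<eta> = \<theta>"
proof (intro ext)
  fix X m
  show "\<eta> X m = \<theta> X m"
    using assms(3)[of X m] hom_mod_undefined[OF assms(1)] hom_mod_undefined[OF assms(2)]
    by (cases "X \<in> Ob E"; cases "m \<in> carrier (Val M X)") simp_all
qed

context
  fixes K :: "('k, 'x) ring_scheme" and E :: "('k, 'o, 'f, 'z) lincat_scheme"
    and M :: "('k, 'o, 'f, 'm) cat_module" and N :: "('k, 'o, 'f, 'n) cat_module"
  assumes M: "right_cat_module K E M" and N: "right_cat_module K E N"
begin

interpretation M: right_cat_module K E M by (rule M)
interpretation N: right_cat_module K E N by (rule N)

text \<open>Restricting to objects and carriers does not disturb naturality, since
  \<open>Mor\<close> maps carriers into carriers.\<close>

lemma hom_mod_restrictI:
  assumes "\<And>X. X \<in> Ob E \<Longrightarrow> \<eta> X \<in> linear_maps K (Val M X) (Val N X)"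
    and "\<And>X Y f m. \<lbrakk>X \<in> Ob E; Y \<in> Ob E; f \<in> carrier (Hom E X Y); m \<in> carrier (Val M Y)\<rbrakk>
      \<Longrightarrow> \<eta> X (Mor M X Y f m) = Mor N X Y f (\<eta> Y m)"
  shows "(\<lambda>X\<in>Ob E. \<lambda>m\<in>carrier (Val M X). \<eta> X m) \<in> carrier (hom_mod K E M N)"
proof -
  have "(\<lambda>m\<in>carrier (Val M X). \<eta> X m) \<in> linear_maps K (Val M X) (Val N X)" if "X \<in> Ob E" for X
  proof -
    interpret V: module K "Val M X" by (rule M.Val_module[OF that])
    show ?thesis
      by (rule linear_mapsI) (simp_all add: linear_mapsD[OF assms(1)[OF that]])
  qed
  then show ?thesis
    using assms(2) bilinear_maps_closed[OF M.Mor_bilinear] by (simp add: hom_mod_def)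
qed

lemma hom_mod_add_closed:
  assumes "\<eta> \<in> carrier (hom_mod K E M N)" and "\<theta> \<in> carrier (hom_mod K E M N)"
  shows "\<eta> \<oplus>\<^bsub>hom_mod K E M N\<^esub> \<theta> \<in> carrier (hom_mod K E M N)"
  unfolding hom_mod_simps
proof (rule hom_mod_restrictI)
  fix X assume X: "X \<in> Ob E"
  interpret V: module K "Val N X" by (rule N.Val_module[OF X])
  show "(\<lambda>m. \<eta> X m \<oplus>\<^bsub>Val N X\<^esub> \<theta> X m) \<in> linear_maps K (Val M X) (Val N X)"
    by (rule linear_mapsI)
      (simp_all add: linear_mapsD[OF hom_mod_linear[OF assms(1) X]]
        linear_mapsD[OF hom_mod_linear[OF assms(2) X]] V.a_ac V.smult_r_distr)
next
  fix X Y f m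
  assume *: "X \<in> Ob E" "Y \<in> Ob E" "f \<in> carrier (Hom E X Y)" "m \<in> carrier (Val M Y)"
  show "\<eta> X (Mor M X Y f m) \<oplus>\<^bsub>Val N X\<^esub> \<theta> X (Mor M X Y f m) = Mor N X Y f (\<eta> Y m \<oplus>\<^bsub>Val N Y\<^esub> \<theta> Y m)"
    using * assms
    by (simp add: hom_mod_natural hom_mod_closed
        linear_maps_add[OF bilinear_maps_right[OF N.Mor_bilinear]])
qed

lemma hom_mod_smult_closed:
  assumes "a \<in> carrier K" and "\<eta> \<in> carrier (hom_mod K E M N)"
  shows "a \<odot>\<^bsub>hom_mod K E M N\<^esub> \<eta> \<in> carrier (hom_mod K E M N)"
  unfolding hom_mod_simps
proof (rule hom_mod_restrictI)
  fix X assume X: "X \<in> Ob E"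
  interpret V: module K "Val N X" by (rule N.Val_module[OF X])
  show "(\<lambda>m. a \<odot>\<^bsub>Val N X\<^esub> \<eta> X m) \<in> linear_maps K (Val M X) (Val N X)"
    using hom_mod_linear[OF assms(2) X] assms(1) by (intro V.smult_linear_maps)
next
  fix X Y f m
  assume *: "X \<in> Ob E" "Y \<in> Ob E" "f \<in> carrier (Hom E X Y)" "m \<in> carrier (Val M Y)"
  show "a \<odot>\<^bsub>Val N X\<^esub> \<eta> X (Mor M X Y f m) = Mor N X Y f (a \<odot>\<^bsub>Val N Y\<^esub> \<eta> Y m)"
    using * assms
    by (simp add: hom_mod_natural hom_mod_closed
        linear_maps_smult[OF bilinear_maps_right[OF N.Mor_bilinear]])
qed

lemma hom_mod_zero_closed: "\<zero>\<^bsub>hom_mod K E M N\<^esub> \<in> carrier (hom_mod K E M N)"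
  unfolding hom_mod_simps
proof (rule hom_mod_restrictI)
  fix X assume X: "X \<in> Ob E"
  interpret V: module K "Val N X" by (rule N.Val_module[OF X])
  show "(\<lambda>m. \<zero>\<^bsub>Val N X\<^esub>) \<in> linear_maps K (Val M X) (Val N X)"
    by (rule linear_mapsI) simp_all
next
  fix X Y f m
  assume *: "X \<in> Ob E" "Y \<in> Ob E" "f \<in> carrier (Hom E X Y)" "m \<in> carrier (Val M Y)"
  then show "\<zero>\<^bsub>Val N X\<^esub> = Mor N X Y f \<zero>\<^bsub>Val N Y\<^esub>"
    by (simp add: linear_maps_zero[OF _ _ bilinear_maps_right[OF N.Mor_bilinear]] N.Val_module)
qed

lemma hom_mod_is_module:
  assumes K: "cring K"
  shows "module K (hom_mod K E M N)"
proof -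
  note closed = hom_mod_add_closed hom_mod_smult_closed hom_mod_zero_closed
  interpret K: cring K by (rule K)
  have V: "module K (Val N X)" if "X \<in> Ob E" for X using that by (rule N.Val_module)
  have ab: "abelian_group (Val N X)" if "X \<in> Ob E" for X using V[OF that] by (rule module.axioms)
  \<comment> \<open>The object varies inside the goals, so the laws of the value modules are kept as
    rules conditional on it instead of being interpreted for one object.\<close>
  note ag = abelian_monoid.a_assoc[OF abelian_group.axioms(1)[OF ab]]
    abelian_monoid.a_comm[OF abelian_group.axioms(1)[OF ab]]
    abelian_monoid.a_lcomm[OF abelian_group.axioms(1)[OF ab]]
    abelian_monoid.l_zero[OF abelian_group.axioms(1)[OF ab]]
    abelian_monoid.a_closed[OF abelian_group.axioms(1)[OF ab]]
    module.smult_closed[OF V] module.smult_l_distr[OF V] module.smult_r_distr[OF V]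
    module.smult_assoc1[OF V] module.smult_one[OF V]
  show ?thesis
  proof (rule moduleI)
    show "cring K" by (rule K)
    show "abelian_group (hom_mod K E M N)"
    proof (rule abelian_groupI)
      fix \<eta> assume \<eta>: "\<eta> \<in> carrier (hom_mod K E M N)"
      have "(\<ominus>\<^bsub>K\<^esub> \<one>\<^bsub>K\<^esub>) \<odot>\<^bsub>hom_mod K E M N\<^esub> \<eta> \<oplus>\<^bsub>hom_mod K E M N\<^esub> \<eta> = \<zero>\<^bsub>hom_mod K E M N\<^esub>"
      proof (rule hom_mod_eqI)
        fix X m assume *: "X \<in> Ob E" "m \<in> carrier (Val M X)"
        interpret V: module K "Val N X" by (rule V[OF *(1)])
        show "((\<ominus>\<^bsub>K\<^esub> \<one>\<^bsub>K\<^esub>) \<odot>\<^bsub>hom_mod K E M N\<^esub> \<eta> \<oplus>\<^bsub>hom_mod K E M N\<^esub> \<eta>) X m = \<zero>\<^bsub>hom_mod K E M N\<^esub> X m"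
          using * hom_mod_closed[OF \<eta> *] by (simp add: hom_mod_simps V.smult_l_minus V.l_neg)
      qed (use \<eta> in \<open>auto intro!: closed\<close>)
      then show "\<exists>\<theta>\<in>carrier (hom_mod K E M N). \<theta> \<oplus>\<^bsub>hom_mod K E M N\<^esub> \<eta> = \<zero>\<^bsub>hom_mod K E M N\<^esub>"
        using closed(2)[OF _ \<eta>] by blast
    qed (auto intro!: closed hom_mod_eqI, auto simp: hom_mod_simps hom_mod_closed ag)
  qed (auto intro!: closed hom_mod_eqI, auto simp: hom_mod_simps hom_mod_closed ag)
qed

text \<open>Linearity of a Sweedler sum in the transformation itself rests on this, as \<eta> enters
  such a sum only through its values.\<close>

lemma hom_mod_eval_linear:
  "\<lbrakk>X \<in> Ob E; m \<in> carrier (Val M X)\<rbrakk>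
    \<Longrightarrow> (\<lambda>\<eta>. \<eta> X m) \<in> linear_maps K (hom_mod K E M N) (Val N X)"
  by (rule linear_mapsI) (simp_all add: hom_mod_simps hom_mod_closed)

end

context smash_module
begin

lemma restrict_smash_simps [simp]:
  "Val (restrict_smash K H C M) = Val M" "Mor (restrict_smash K H C M) X Y f = cact X Y f"
  by (simp_all add: restrict_smash_def cact_def fun_eq_iff)

text \<open>Restriction along f \<mapsto> f # 1, which preserves identities by definition and
  composition by \<open>smash_Cmp_pure_one\<close>.\<close>

lemma restrict_smash_right_cat_module: "right_cat_module K C (restrict_smash K H C M)"
proof (rule right_cat_module.intro)
  show "Mor (restrict_smash K H C M) X Y
      \<in> bilinear_maps K (Hom C X Y) (Val (restrict_smash K H C M) Y) (Val (restrict_smash K H C M) X)"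
    if "X \<in> Ob C" "Y \<in> Ob C" for X Y
    using that by (intro bilinear_mapsI) (simp_all, (intro linear_intros linear_maps_id; simp)+)
  show "Mor (restrict_smash K H C M) X X (Idt C X) m = m"
    if "X \<in> Ob C" "m \<in> carrier (Val (restrict_smash K H C M) X)" for X m
    using that Mor_Idt by (simp add: cact_def)
  show "Mor (restrict_smash K H C M) X Z (Cmp C X Y Z f g) m
      = Mor (restrict_smash K H C M) X Y g (Mor (restrict_smash K H C M) Y Z f m)"
    if "X \<in> Ob C" "Y \<in> Ob C" "Z \<in> Ob C" "f \<in> carrier (Hom C Y Z)" "g \<in> carrier (Hom C X Y)"
      "m \<in> carrier (Val (restrict_smash K H C M) Z)" for X Y Z f g m
    using that by (simp add: cact_def Mor_Cmp[symmetric] smash_Cmp_pure_one)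
qed simp

end

locale smash_module_pair = left_H_category K H C + M: smash_module K H C M + N: smash_module K H C N
  for K :: "('k, 'x) ring_scheme" and H :: "('k, 'h, 'y) hopf_scheme"
    and C :: "('k, 'o, 'f, 'h, 'z) hcat_scheme"
    and M :: "('k, 'o, ('f \<times> 'h \<Rightarrow> 'k) set, 'm) cat_module"
    and N :: "('k, 'o, ('f \<times> 'h \<Rightarrow> 'k) set, 'n) cat_module"
begin

abbreviation "V \<equiv> hom_mod K C (restrict_smash K H C M) (restrict_smash K H C N)"
abbreviation "act \<equiv> hom_act K H C M N"

section \<open>The Hopf action on linear natural transformations\<close>

lemma V_module: "module K V"
  by (rule hom_mod_is_module[OF M.restrict_smash_right_cat_module N.restrict_smash_right_cat_module is_cring])

lemma V_linear: "\<eta> \<in> carrier V \<Longrightarrow> X \<in> Ob C \<Longrightarrow> \<eta> X \<in> linear_maps K (Val M X) (Val N X)"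
  using hom_mod_linear[of \<eta> K C "restrict_smash K H C M" "restrict_smash K H C N" X] by simp

lemma V_linear_comp:
  "\<lbrakk>\<eta> \<in> carrier V; X \<in> Ob C; f \<in> linear_maps K W (Val M X)\<rbrakk>
    \<Longrightarrow> (\<lambda>w. \<eta> X (f w)) \<in> linear_maps K W (Val N X)"
  by (rule linear_maps_comp[OF _ V_linear])

lemma V_natural:
  "\<lbrakk>\<eta> \<in> carrier V; X \<in> Ob C; Y \<in> Ob C; f \<in> carrier (Hom C X Y); m \<in> carrier (Val M Y)\<rbrakk>
    \<Longrightarrow> \<eta> X (M.cact X Y f m) = N.cact X Y f (\<eta> Y m)"
  using hom_mod_natural[of \<eta> K C "restrict_smash K H C M" "restrict_smash K H C N" X Y f m] by simp

lemma V_closed [simp]: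
  "\<lbrakk>\<eta> \<in> carrier V; X \<in> Ob C; m \<in> carrier (Val M X)\<rbrakk> \<Longrightarrow> \<eta> X m \<in> carrier (Val N X)"
  by (rule linear_maps_closed[OF V_linear])

lemma V_eval_linear:
  "\<lbrakk>X \<in> Ob C; m \<in> carrier (Val M X)\<rbrakk> \<Longrightarrow> (\<lambda>\<eta>. \<eta> X m) \<in> linear_maps K V (Val N X)"
  using hom_mod_eval_linear[OF M.restrict_smash_right_cat_module N.restrict_smash_right_cat_module, of X m]
  by simp

lemma V_eqI:
  assumes "\<eta> \<in> carrier V" and "\<theta> \<in> carrier V"
    and "\<And>X m. X \<in> Ob C \<Longrightarrow> m \<in> carrier (Val M X) \<Longrightarrow> \<eta> X m = \<theta> X m"
  shows "\<eta> = \<theta>"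
  using assms(3) by (intro hom_mod_eqI[OF assms(1,2)]) simp

lemma hom_act_eq:
  assumes "X \<in> Ob C" and "m \<in> carrier (Val M X)"
  shows "act h \<eta> X m = sweedler K H (Val N X)
    (\<lambda>a b. N.ract X (antipode H a) (\<eta> X (M.ract X (antipode H (antipode H b)) m))) h"
  using assms by (simp add: hom_act_def M.val_act_eq_ract N.val_act_eq_ract)

text \<open>Both commutation rules together give (h \<cdot> \<eta>)(m f) = \<Sum> (\<eta>(m
  S^2(h_4)) S(h_1)) (h_2 S(h_3) f), and \<open>sweedler_cancel_middle\<close> removes the element
  acting on f.\<close>

lemma hom_act_natural:
  assumes \<eta>: "\<eta> \<in> carrier V" and h: "h \<in> carrier H" and X: "X \<in> Ob C" and Y: "Y \<in> Ob C"
    and f: "f \<in> carrier (Hom C X Y)" and m: "m \<in> carrier (Val M Y)"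
  shows "act h \<eta> X (M.cact X Y f m) = N.cact X Y f (act h \<eta> Y m)"
proof -
  let ?s = "sweedler K H (Val N X)" and ?S = "antipode H"
  note intros = linear_intros linear_maps_id module_H M.Val_module' N.Val_module' V_linear_comp[OF \<eta>]
  have "act h \<eta> X (M.cact X Y f m)
      = ?s (\<lambda>a b. N.ract X (?S a) (\<eta> X (M.ract X (?S (?S b)) (M.cact X Y f m)))) h"
    using X Y f m by (simp add: hom_act_eq)
  also have "\<dots> = ?s (\<lambda>h\<^sub>1 h\<^sub>2. N.ract X (?S h\<^sub>1) (\<eta> X (sweedler K H (Val M X) (\<lambda>c d.
      M.cact X Y (Act C X Y (?S c) f) (M.ract Y (?S (?S d)) m)) h\<^sub>2))) h"
    using X Y f m h \<eta> by (intro sweedler_cong) (simp_all add: M.ract_antipode_antipode_cact)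
  also have "\<dots> = ?s (\<lambda>h\<^sub>1 h\<^sub>2. ?s (\<lambda>c d. N.ract X (?S h\<^sub>1)
      (\<eta> X (M.cact X Y (Act C X Y (?S c) f) (M.ract Y (?S (?S d)) m)))) h\<^sub>2) h"
    using X Y f m h \<eta>
    by (intro sweedler_cong sweedler_comp[where f = "\<lambda>w. N.ract X _ (\<eta> X w)"] intros) simp_all
  \<comment> \<open>Naturality of \<eta> carries f over to the target module; there S(h_1) is moved
    past it, which splits h_1 into \<open>a\<close> and \<open>b\<close>.\<close>
  also have "\<dots> = ?s (\<lambda>h\<^sub>1 h\<^sub>2. ?s (\<lambda>c d. ?s (\<lambda>a b. N.cact X Y (Act C X Y (b \<otimes>\<^bsub>H\<^esub> ?S c) f)
      (N.ract Y (?S a) (\<eta> Y (M.ract Y (?S (?S d)) m)))) h\<^sub>1) h\<^sub>2) h"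
    using X Y f m h \<eta>
    by (intro sweedler_cong) (simp_all add: V_natural N.ract_antipode_cact Act_mult cong: sweedler_cong)
  also have "\<dots> = ?s (\<lambda>a d. N.cact X Y (Act C X Y \<one>\<^bsub>H\<^esub> f)
      (N.ract Y (?S a) (\<eta> Y (M.ract Y (?S (?S d)) m)))) h"
    using X Y f m h \<eta>
    by (intro sweedler_cancel_middle[where \<psi> = "\<lambda>a w d. N.cact X Y (Act C X Y w f)
        (N.ract Y (?S a) (\<eta> Y (M.ract Y (?S (?S d)) m)))"] intros) simp_all
  also have "\<dots> = N.cact X Y f (sweedler K H (Val N Y) (\<lambda>a d.
      N.ract Y (?S a) (\<eta> Y (M.ract Y (?S (?S d)) m))) h)"
    using X Y f m h \<eta>
    by (simp only: Act_one) (intro sweedler_comp[where f = "N.cact X Y f", symmetric] intros; simp)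
  finally show ?thesis
    using Y m by (simp add: hom_act_eq)
qed

text \<open>\<open>hom_act\<close> is restricted to objects and carriers by definition, so
  \<open>hom_mod_restrictI\<close> leaves linearity of the components and naturality of the
  unrestricted formula.\<close>

lemma hom_act_closed:
  assumes \<eta>: "\<eta> \<in> carrier V" and h: "h \<in> carrier H"
  shows "act h \<eta> \<in> carrier V"
proof -
  note intros = linear_intros linear_maps_id module_H M.Val_module' N.Val_module' V_linear_comp[OF \<eta>]
  let ?\<theta> = "\<lambda>X m. sweedler K H (Val N X)
    (\<lambda>a b. N.ract X (antipode H a) (\<eta> X (M.ract X (antipode H (antipode H b)) m))) h"
  have "act h \<eta> = (\<lambda>X\<in>Ob C. \<lambda>m\<in>carrier (Val M X). ?\<theta> X m)"
    unfolding hom_act_def M.val_act_eq_ract N.val_act_eq_ract ..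
  moreover have "\<dots> \<in> carrier V"
  proof -
    have "?\<theta> X (M.cact X Y f m) = N.cact X Y f (?\<theta> Y m)"
      if "X \<in> Ob C" "Y \<in> Ob C" "f \<in> carrier (Hom C X Y)" "m \<in> carrier (Val M Y)" for X Y f m
      using that hom_act_natural[OF \<eta> h that] by (simp add: hom_act_eq)
    moreover have "?\<theta> X \<in> linear_maps K (Val M X) (Val N X)" if "X \<in> Ob C" for X
      using that h by (intro intros) simp_all
    ultimately show ?thesis
      using hom_mod_restrictI[OF M.restrict_smash_right_cat_module N.restrict_smash_right_cat_module, of ?\<theta>]
      by simp
  qed
  ultimately show ?thesis by simp
qed

text \<open>Elements of \<open>V\<close> are compared at each object and vector, where the value is
  linear in \<open>h\<close> as a Sweedler sum and linear in \<eta> through evaluation.\<close>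

lemma hom_act_bilinear: "act \<in> bilinear_maps K H V V"
proof (intro bilinear_mapsI linear_mapsI)
  note intros = linear_intros linear_maps_id module_H M.Val_module' N.Val_module' V_module
    V_linear_comp V_eval_linear
  interpret V: module K V by (rule V_module)
  have lin_h: "(\<lambda>h. act h \<eta> X m) \<in> linear_maps K H (Val N X)"
    if "\<eta> \<in> carrier V" "X \<in> Ob C" "m \<in> carrier (Val M X)" for \<eta> X m
    unfolding hom_act_eq[OF that(2,3)] using that by (intro intros) simp_all
  have lin_\<eta>: "(\<lambda>\<eta>. act h \<eta> X m) \<in> linear_maps K V (Val N X)"
    if "h \<in> carrier H" "X \<in> Ob C" "m \<in> carrier (Val M X)" for h X m
    unfolding hom_act_eq[OF that(2,3)] using that
    by (intro intros) simp_all
  fix h \<eta> assume h: "h \<in> carrier H" and \<eta>: "\<eta> \<in> carrier V"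
  then show "act h \<eta> \<in> carrier V" by (intro hom_act_closed)
  then show "act h \<eta> \<in> carrier V" .
  show "act h (\<eta> \<oplus>\<^bsub>V\<^esub> \<theta>) = act h \<eta> \<oplus>\<^bsub>V\<^esub> act h \<theta>" if "\<theta> \<in> carrier V" for \<theta>
    using h \<eta> that
    by (intro V_eqI hom_act_closed V.a_closed)
      (simp_all add: linear_maps_add[OF lin_\<eta>], simp add: hom_mod_simps)
  show "act h (c \<odot>\<^bsub>V\<^esub> \<eta>) = c \<odot>\<^bsub>V\<^esub> act h \<eta>" if "c \<in> carrier K" for c
    using h \<eta> that
    by (intro V_eqI hom_act_closed V.smult_closed)
      (simp_all add: linear_maps_smult[OF lin_\<eta>], simp add: hom_mod_simps)
  show "act (h \<oplus>\<^bsub>H\<^esub> g) \<eta> = act h \<eta> \<oplus>\<^bsub>V\<^esub> act g \<eta>" if "g \<in> carrier H" for g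
    using h \<eta> that
    by (intro V_eqI hom_act_closed V.a_closed)
      (simp_all add: linear_maps_add[OF lin_h], simp add: hom_mod_simps)
  show "act (c \<odot>\<^bsub>H\<^esub> h) \<eta> = c \<odot>\<^bsub>V\<^esub> act h \<eta>" if "c \<in> carrier K" for c
    using h \<eta> that
    by (intro V_eqI hom_act_closed V.smult_closed)
      (simp_all add: linear_maps_smult[OF lin_h], simp add: hom_mod_simps)
qed

lemma hom_act_mult:
  assumes g: "g \<in> carrier H" and h: "h \<in> carrier H" and \<eta>: "\<eta> \<in> carrier V"
  shows "act (g \<otimes>\<^bsub>H\<^esub> h) \<eta> = act g (act h \<eta>)"
proof (rule V_eqI)
  fix X m assume X: "X \<in> Ob C" and m: "m \<in> carrier (Val M X)"
  let ?s = "sweedler K H (Val N X)" and ?S = "antipode H"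
  note intros = linear_intros linear_maps_id module_H M.Val_module' N.Val_module' V_linear_comp[OF \<eta>]
  have bil: "(\<lambda>a b. N.ract X (?S a) (\<eta> X (M.ract X (?S (?S b)) m))) \<in> bilinear_maps K H H (Val N X)"
    using X m \<eta> by (intro bilinear_mapsI intros) simp_all
  have "act (g \<otimes>\<^bsub>H\<^esub> h) \<eta> X m = ?s (\<lambda>a b. ?s (\<lambda>c d.
      N.ract X (?S (a \<otimes>\<^bsub>H\<^esub> c)) (\<eta> X (M.ract X (?S (?S (b \<otimes>\<^bsub>H\<^esub> d))) m))) h) g"
    using X m by (simp add: hom_act_eq sweedler_mult[OF _ bil g h])
  \<comment> \<open>S reverses products and \<open>ract\<close> reverses them again, so the parts of
    \<open>h\<close> act inside those of \<open>g\<close> on the values of \<eta>. S^2 preserves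
    products, so on its argument the part of \<open>g\<close> is applied first.\<close>
  also have "\<dots> = ?s (\<lambda>a b. ?s (\<lambda>c d. N.ract X (?S a) (N.ract X (?S c)
      (\<eta> X (M.ract X (?S (?S d)) (M.ract X (?S (?S b)) m))))) h) g"
    using X m g h \<eta>
    by (intro sweedler_cong sweedler_closed) (simp_all add: antipode_mult M.ract_mult N.ract_mult)
  also have "\<dots> = ?s (\<lambda>a b. N.ract X (?S a) (act h \<eta> X (M.ract X (?S (?S b)) m))) g"
  proof (intro sweedler_cong sweedler_closed)
    fix a b assume ab: "a \<in> carrier H" "b \<in> carrier H"
    then have n: "M.ract X (?S (?S b)) m \<in> carrier (Val M X)" using X m by simp
    show "?s (\<lambda>c d. N.ract X (?S a) (N.ract X (?S c)
        (\<eta> X (M.ract X (?S (?S d)) (M.ract X (?S (?S b)) m))))) h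
      = N.ract X (?S a) (act h \<eta> X (M.ract X (?S (?S b)) m))"
      unfolding hom_act_eq[OF X n] using X m h \<eta> ab
      by (intro sweedler_comp[where f = "N.ract X _", symmetric] intros) simp_all
  qed (use X m g h \<eta> in simp_all)
  finally show "act (g \<otimes>\<^bsub>H\<^esub> h) \<eta> X m = act g (act h \<eta>) X m"
    using X m by (simp add: hom_act_eq[of X m g])
qed (use assms in \<open>auto intro!: hom_act_closed\<close>)

lemma hom_act_one:
  assumes \<eta>: "\<eta> \<in> carrier V"
  shows "act \<one>\<^bsub>H\<^esub> \<eta> = \<eta>"
proof (rule V_eqI)
  fix X m assume X: "X \<in> Ob C" and m: "m \<in> carrier (Val M X)"
  note intros = linear_intros linear_maps_id module_H M.Val_module' N.Val_module' V_linear_comp[OF \<eta>]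
  have "(\<lambda>a b. N.ract X (antipode H a) (\<eta> X (M.ract X (antipode H (antipode H b)) m)))
      \<in> bilinear_maps K H H (Val N X)"
    using X m \<eta> by (intro bilinear_mapsI intros) simp_all
  from sweedler_one[OF _ this] show "act \<one>\<^bsub>H\<^esub> \<eta> X m = \<eta> X m"
    using X m \<eta> by (simp add: hom_act_eq antipode_one M.ract_one N.ract_one)
qed (use assms in \<open>auto intro!: hom_act_closed\<close>)

lemma hom_act_left_module: "left_module K H V act"
  by (intro left_module.intro left_module_axioms.intro assoc_algebra_axioms V_module
      hom_act_bilinear hom_act_mult hom_act_one)

text \<open>If \<eta> commutes with the action of \<open>H\<close>, both actions gather in its
  argument as m S(h_1 S(h_2)), which the antipode axiom reduces to \<epsilon>(h) m.\<close>

lemma hom_act_of_ract_linear: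
  assumes \<eta>: "\<eta> \<in> carrier V" and h: "h \<in> carrier H" and X: "X \<in> Ob C" and m: "m \<in> carrier (Val M X)"
    and ract: "\<And>k n. k \<in> carrier H \<Longrightarrow> n \<in> carrier (Val M X) \<Longrightarrow> \<eta> X (M.ract X k n) = N.ract X k (\<eta> X n)"
  shows "act h \<eta> X m = counit H h \<odot>\<^bsub>Val N X\<^esub> \<eta> X m"
proof -
  let ?s = "sweedler K H (Val N X)" and ?S = "antipode H"
  note intros = linear_intros linear_maps_id module_H M.Val_module' N.Val_module' V_linear_comp[OF \<eta>]
  have "act h \<eta> X m = ?s (\<lambda>a b. \<eta> X (M.ract X (?S (a \<otimes>\<^bsub>H\<^esub> ?S b)) m)) h"
    unfolding hom_act_eq[OF X m] using \<eta> h X m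
    by (intro sweedler_cong) (simp_all add: ract antipode_mult N.ract_mult)
  also have "\<dots> = counit H h \<odot>\<^bsub>Val N X\<^esub> \<eta> X (M.ract X (?S \<one>\<^bsub>H\<^esub>) m)"
    using \<eta> h X m
    by (intro sweedler_antipode_right[where f = "\<lambda>w. \<eta> X (M.ract X (?S w) m)"] intros) simp_all
  finally show ?thesis using X m by (simp add: antipode_one M.ract_one)
qed

lemma ract_antipode_of_invariant:
  assumes \<eta>: "\<eta> \<in> carrier V" and X: "X \<in> Ob C" and m: "m \<in> carrier (Val M X)" and h: "h \<in> carrier H"
    and inv: "\<And>k n. k \<in> carrier H \<Longrightarrow> n \<in> carrier (Val M X)
      \<Longrightarrow> act k \<eta> X n = counit H k \<odot>\<^bsub>Val N X\<^esub> \<eta> X n"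
  shows "\<eta> X (M.ract X (antipode H h) m) = N.ract X (antipode H h) (\<eta> X m)"
proof -
  interpret VN: module K "Val N X" using X by (rule N.Val_module')
  let ?s = "sweedler K H (Val N X)" and ?S = "antipode H"
  note intros = linear_intros linear_maps_id module_H M.Val_module' N.Val_module' V_linear_comp[OF \<eta>]
  \<comment> \<open>The identity is inserted as S(1), and then 1 is expanded to S(h_2) h_3; this
    creates the three factors among which the invariance pattern appears.\<close>
  have "N.ract X (?S h) (\<eta> X m) = N.ract X (?S h) (\<eta> X (M.ract X (?S \<one>\<^bsub>H\<^esub>) m))"
    using X m by (simp add: antipode_one M.ract_one)
  also have "\<dots> = ?s (\<lambda>a c. ?s (\<lambda>b d. N.ract X (?S a) (\<eta> X (M.ract X (?S (?S b \<otimes>\<^bsub>H\<^esub> d)) m))) c) h"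
    using \<eta> X m h
    by (intro sweedler_cancel_right_antipode[where
          \<psi> = "\<lambda>a w. N.ract X (?S a) (\<eta> X (M.ract X (?S w) m))", symmetric] intros) simp_all
  also have "\<dots> = ?s (\<lambda>a c. ?s (\<lambda>b d. N.ract X (?S a)
      (\<eta> X (M.ract X (?S (?S b)) (M.ract X (?S d) m)))) c) h"
    using \<eta> X m h by (intro sweedler_cong sweedler_closed) (simp_all add: antipode_mult M.ract_mult)
  also have "\<dots> = ?s (\<lambda>c d. ?s (\<lambda>a b. N.ract X (?S a)
      (\<eta> X (M.ract X (?S (?S b)) (M.ract X (?S d) m)))) c) h"
    using \<eta> X m h by (intro sweedler_coassoc[symmetric] intros) simp_all
  \<comment> \<open>After regrouping, the inner sum is (h_1 \<cdot> \<eta>)(m S(h_2)); invariance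
    turns it into a counit, which the outer sum absorbs.\<close>
  also have "\<dots> = ?s (\<lambda>c d. counit H c \<odot>\<^bsub>Val N X\<^esub> \<eta> X (M.ract X (?S d) m)) h"
    using \<eta> X m h by (intro sweedler_cong) (simp_all add: inv hom_act_eq[symmetric])
  also have "\<dots> = \<eta> X (M.ract X (?S h) m)"
    using \<eta> X m h by (intro sweedler_counit_left intros) simp_all
  finally show ?thesis by simp
qed

text \<open>Naturality over the smash product is specialized to the morphisms f # 1; the underlying
  spaces are the same.\<close>

lemma smash_hom_subset: "carrier (hom_mod K (smash K H C) M N) \<subseteq> carrier V"
  by (auto simp: hom_mod_def M.cact_def N.cact_def)

text \<open>For a fixed vector both sides of the naturality square are linear in the morphism, so
  pure tensors suffice, and on these f and \<open>k\<close> act one after the other.\<close>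

lemma smash_homI:
  assumes \<eta>: "\<eta> \<in> carrier V"
    and ract: "\<And>X k m. \<lbrakk>X \<in> Ob C; k \<in> carrier H; m \<in> carrier (Val M X)\<rbrakk>
      \<Longrightarrow> \<eta> X (M.ract X k m) = N.ract X k (\<eta> X m)"
  shows "\<eta> \<in> carrier (hom_mod K (smash K H C) M N)"
proof -
  have "\<eta> X (Mor M X Y s m) = Mor N X Y s (\<eta> Y m)"
    if X: "X \<in> Ob C" and Y: "Y \<in> Ob C" and s: "s \<in> carrier (tensor K (Hom C X Y) H)"
      and m: "m \<in> carrier (Val M Y)" for X Y s m
  proof (rule tensor_linear_eqI[OF Hom_module[OF X Y] module_H N.Val_module'[OF X] _ _ _ s])
    show "(\<lambda>s. \<eta> X (Mor M X Y s m)) \<in> linear_maps K (tensor K (Hom C X Y) H) (Val N X)"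
      using \<eta> X Y m by (intro V_linear_comp M.linear_maps_Mor linear_maps_id)
    show "(\<lambda>s. Mor N X Y s (\<eta> Y m)) \<in> linear_maps K (tensor K (Hom C X Y) H) (Val N X)"
      using \<eta> X Y m by (intro N.linear_maps_Mor linear_maps_id V_closed)
    show "\<eta> X (Mor M X Y (pure_tensor K (Hom C X Y) H f k) m)
        = Mor N X Y (pure_tensor K (Hom C X Y) H f k) (\<eta> Y m)"
      if "f \<in> carrier (Hom C X Y)" "k \<in> carrier H" for f k
      using that \<eta> X Y m by (simp add: M.Mor_pure_eq N.Mor_pure_eq ract V_natural)
  qed
  then show ?thesis
    using \<eta> by (simp add: hom_mod_def)
qed

lemma hom_act_invariants:
  assumes "bij_betw (antipode H) (carrier H) (carrier H)"
  shows "invariants H V act = carrier (hom_mod K (smash K H C) M N)"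
proof (intro equalityI subsetI)
  fix \<eta> assume "\<eta> \<in> invariants H V act"
  then have \<eta>: "\<eta> \<in> carrier V" and inv: "\<And>h. h \<in> carrier H \<Longrightarrow> act h \<eta> = counit H h \<odot>\<^bsub>V\<^esub> \<eta>"
    by (auto simp: invariants_def)
  show "\<eta> \<in> carrier (hom_mod K (smash K H C) M N)"
  proof (rule smash_homI[OF \<eta>])
    fix X k m assume *: "X \<in> Ob C" "k \<in> carrier H" "m \<in> carrier (Val M X)"
    \<comment> \<open>Invariance gives commutation with \<M>(id # S(h)), so an arbitrary
      \<open>k\<close> has to be written as a value of the antipode.\<close>
    obtain h where h: "h \<in> carrier H" "k = antipode H h"
      using bij_betw_imp_surj_on[OF assms] *(2) by blast
    show "\<eta> X (M.ract X k m) = N.ract X k (\<eta> X m)"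
      unfolding h(2) using * h(1)
      by (intro ract_antipode_of_invariant[OF \<eta>]) (simp_all add: inv hom_mod_simps)
  qed
next
  fix \<eta> assume hom: "\<eta> \<in> carrier (hom_mod K (smash K H C) M N)"
  then have \<eta>: "\<eta> \<in> carrier V" using smash_hom_subset by blast
  interpret V: module K V by (rule V_module)
  \<comment> \<open>This is naturality at the endomorphism id # k of the smash product.\<close>
  have ract: "\<eta> X (M.ract X k m) = N.ract X k (\<eta> X m)"
    if "X \<in> Ob C" "k \<in> carrier H" "m \<in> carrier (Val M X)" for X k m
    unfolding M.ract_def N.ract_def using that hom_mod_natural[OF hom] by (simp add: Idt_closed)
  have "act h \<eta> = counit H h \<odot>\<^bsub>V\<^esub> \<eta>" if h: "h \<in> carrier H" for h
    using \<eta> h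
    by (intro V_eqI hom_act_closed V.smult_closed)
      (simp_all add: hom_act_of_ract_linear ract, simp add: hom_mod_simps)
  with \<eta> show "\<eta> \<in> invariants H V act" by (simp add: invariants_def)
qed

end

theorem proposition3p8:
  fixes K :: "('k, 'x) ring_scheme"
    and H :: "('k, 'h, 'y) hopf_scheme"
    and C :: "('k, 'o, 'f, 'h, 'z) hcat_scheme"
    and M :: "('k, 'o, ('f \<times> 'h \<Rightarrow> 'k) set, 'm) cat_module"
    and N :: "('k, 'o, ('f \<times> 'h \<Rightarrow> 'k) set, 'n) cat_module"
  assumes "left_H_category K H C"
    and "bij_betw (antipode H) (carrier H) (carrier H)"
    and "right_cat_module K (smash K H C) M"
    and "right_cat_module K (smash K H C) N"
  shows "left_module K H
           (hom_mod K C (restrict_smash K H C M) (restrict_smash K H C N))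
           (hom_act K H C M N)
         \<and> invariants H
           (hom_mod K C (restrict_smash K H C M) (restrict_smash K H C N))
           (hom_act K H C M N)
         = carrier (hom_mod K (smash K H C) M N)"
proof -
  interpret smash_module_pair K H C M N
    using assms by (intro smash_module_pair.intro smash_module.intro)
  show ?thesis
    using hom_act_left_module hom_act_invariants[OF assms(2)] by blast
qed

end
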